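(* Let $\varphi\colon P_n(M)\to\mathbb{R}$ be a homogeneous quasimorphism vanishing on the centre of $P_n(M)$; if $M$ is a surface, assume that $M$ is closed of positive genus and that $\varphi$ vanishes on $P_n(\Delta)$. Let $\Psi\colon\mathrm{Homeo}_0(M)\to\mathbb{R}$ be defined by $$\Psi(f)=\int_{C_n(M)}\varphi(\gamma(f,x))\,dx .$$ Let $f\in\mathrm{Homeo}_0(M)$. If $$\limsup_{k\to\infty}\frac{|\Psi(f^k)|}{k}>0,$$ then $f$ is undistorted in $\mathrm{Homeo}_0(M)$.
   Context: $M$ is a smooth compact oriented connected manifold of dimension at least $2$ with a Borel probability measure $\mu$ defined by a volume form. If $\dim M=2$, $n\ge 1$ is an arbitrary integer; if $\dim M\geq 3$, $n=1$. $\mathrm{Homeo}_0(M)$ is the group of homeomorphisms of $M$ which are the identity on a neighbourhood of $\partial M$ and are isotopic to the identity. $C_n(M)\subset M^n$ is the space of ordered configurations of $n$ distinct points, with the product action of $\mathrm{Homeo}_0(M)$ and the product measure $\mu^n$. $P_n(M)=\pi_1(C_n(M),z)$ is the pure braid group (so $P_1(M)=\pi_1(M)$). $\Delta\subseteq M$ is the interior of the unique top-dimensional cell in a CW-decomposition of $M$ with one top-dimensional cell; it is diffeomorphic to a Euclidean ball and has full measure. The base-point $z=(z_1,\dots,z_n)\in C_n(M)$ has all $z_i\in\Delta$. $P_n(\Delta)\le P_n(M)$ is the image of $\pi_1(C_n(\Delta),z)$ under the inclusion. Concatenation of paths is read from right to left. For $x,y\in C_n(\Delta)$, $\ell_{y,x}$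 is the path from $x$ to $y$ consisting of the $n$ unit speed geodesics from $x_i$ to $y_i$ in the Euclidean metric on $\Delta$. If $M$ is a surface and $n>1$, these geodesics may collide, and then $\ell_{y,x}$ is not defined; this is regarded as happening only on a set of measure zero, not affecting the integral. For $f\in\mathrm{Homeo}_0(M)$, an isotopy $\{f_t\}$ from the identity to $f$, and $x\in C_n(\Delta)$ with $f(x)\in C_n(\Delta)$, put $$\gamma(f,x)=[\ell_{z,f(x)}*\{f_t(x)\}*\ell_{x,z}]\in P_n(M).$$ These braids are taken to be defined for $x$ in a set of full measure. The braid $\gamma(f,x)$ is independent of the isotopy up to a factor in the centre of $P_n(M)$, and $\varphi(\gamma(f,x))$ does not depend on the isotopy since $\varphi$ is homogeneous and vanishes on the centre. A quasimorphism on a group $G$ is a function $\varphi\colon G\to\mathbb{R}$ with $\sup_{g,h}|\varphi(h)-\varphi(gh)+\varphi(g)|<\infty$; it is homogeneous if $\varphi(g^k)=k\varphi(g)$ for all $g\in G$, $k\in\mathbb{Z}$. An element $g$ of a finitely generated group $\Gamma$ is undistorted if $\lim_{k\to\infty}|g^k|/k>0$, where $|\cdot|$ is the word norm with respect to any finite generating set. An element of an arbitrary group $G$ is undistorted if it is undistorted in every finitely generated subgroup of $G$ containing it. *)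

theory Defs
  imports
    "HOL-Analysis.Analysis"
    "HOL-Probability.Probability_Measure"
    "HOL-Algebra.Generated_Groups"
begin

section \<open>Smooth manifolds with boundary\<close>

text \<open>
  The manifold \<open>M\<close> is the whole Hausdorff space \<open>UNIV :: 'a set\<close>, its dimension is \<open>CARD('d)\<close>.
  Second countability is not required separately, because it follows from compactness.
\<close>

primrec Ck_on :: "nat \<Rightarrow> 'e::euclidean_space set \<Rightarrow> ('e \<Rightarrow> 'b::real_normed_vector) \<Rightarrow> bool" where
  "Ck_on 0 V f \<longleftrightarrow> continuous_on V f"
| "Ck_on (Suc k) V f \<longleftrightarrow> (\<forall>x\<in>V. f differentiable (at x)) \<and>
     (\<forall>v. Ck_on k V (\<lambda>x. frechet_derivative f (at x) v))"

text \<open>On a set that is not open, smoothness means existence of local smooth extensions.\<close>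

definition smooth_on :: "'e::euclidean_space set \<Rightarrow> ('e \<Rightarrow> 'b::real_normed_vector) \<Rightarrow> bool" where
  "smooth_on S f \<longleftrightarrow> (\<forall>x\<in>S. \<exists>V g. open V \<and> x \<in> V \<and> (\<forall>k. Ck_on k V g) \<and> (\<forall>y\<in>V \<inter> S. g y = f y))"

text \<open>The index type carries no order, so the distinguished coordinate is an arbitrary fixed one.\<close>

definition half_space :: "(real^'d) set" where
  "half_space = {v. 0 \<le> v $ (SOME i. True)}"

type_synonym ('a, 'd) chart = "'a set \<times> ('a \<Rightarrow> real^'d)"

definition smooth_atlas :: "('a::topological_space, 'd::finite) chart set \<Rightarrow> bool" where
  "smooth_atlas A \<longleftrightarrow>
     (\<Union>(U, c)\<in>A. U) = UNIV \<and>
     (\<forall>(U, c)\<in>A. open U \<and> openin (top_of_set half_space) (c ` U) \<and>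
        homeomorphism U (c ` U) c (inv_into U c)) \<and>
     (\<forall>(U, c)\<in>A. \<forall>(U', c')\<in>A. smooth_on (c ` (U \<inter> U')) (c' \<circ> inv_into U c))"

text \<open>
  An orientation is an atlas whose transition maps have positive Jacobian determinant. (In
  dimension at least two, every oriented manifold with boundary has such an atlas modelled on the
  half-space.) The derivative is taken within the image of the chart overlap, where it is unique
  even at boundary points.
\<close>

definition oriented_atlas :: "('a::topological_space, 'd::finite) chart set \<Rightarrow> bool" where
  "oriented_atlas A \<longleftrightarrow> smooth_atlas A \<and>
     (\<forall>(U, c)\<in>A. \<forall>(U', c')\<in>A. \<forall>x\<in>U \<inter> U'. \<forall>D.
        ((c' \<circ> inv_into U c) has_derivative D) (at (c x) within c ` (U \<inter> U')) \<longrightarrow>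
        0 < det (matrix D))"

definition mboundary :: "('a, 'd::finite) chart set \<Rightarrow> 'a set" where
  "mboundary A = {x. \<exists>(U, c)\<in>A. x \<in> U \<and> c x \<in> frontier half_space}"

text \<open>
  A volume form (positive for the orientation) is given by its coefficient functions: in the
  chart \<open>(U, c)\<close> it is \<open>\<omega> (U, c) dv\<^sub>1 \<and> \<dots> \<and> dv\<^sub>d\<close>.
\<close>

definition volume_form ::
    "('a::topological_space, 'd::finite) chart set \<Rightarrow> (('a, 'd) chart \<Rightarrow> real^'d \<Rightarrow> real) \<Rightarrow> bool" where
  "volume_form A \<omega> \<longleftrightarrow>
     (\<forall>(U, c)\<in>A. smooth_on (c ` U) (\<omega> (U, c)) \<and> (\<forall>v\<in>c ` U. 0 < \<omega> (U, c) v)) \<and>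
     (\<forall>(U, c)\<in>A. \<forall>(U', c')\<in>A. \<forall>x\<in>U \<inter> U'. \<forall>D.
        ((c' \<circ> inv_into U c) has_derivative D) (at (c x) within c ` (U \<inter> U')) \<longrightarrow>
        \<omega> (U, c) (c x) = \<omega> (U', c') (c' x) * det (matrix D))"

definition volume_form_measure ::
    "('a::topological_space, 'd::finite) chart set \<Rightarrow> (('a, 'd) chart \<Rightarrow> real^'d \<Rightarrow> real) \<Rightarrow>
      'a measure \<Rightarrow> bool" where
  "volume_form_measure A \<omega> \<mu> \<longleftrightarrow> sets \<mu> = sets borel \<and>
     (\<forall>(U, c)\<in>A. \<forall>B\<in>sets borel. B \<subseteq> U \<longrightarrow>
        emeasure \<mu> B = (\<integral>\<^sup>+v\<in>c ` B. ennreal (\<omega> (U, c) v) \<partial>lborel))"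

text \<open>
  The genus of a connected closed oriented surface: the largest number of disjoint simple closed
  curves whose union does not disconnect it.
\<close>

definition genus :: "'a::topological_space set \<Rightarrow> enat" where
  "genus X = Sup {enat (card C) | C. finite C \<and> disjoint C \<and>
     (\<forall>c\<in>C. \<exists>p. simple_path p \<and> pathfinish p = pathstart p \<and> path_image p = c \<and> c \<subseteq> X) \<and>
     connected (X - \<Union>C)}"


section \<open>Cell decompositions\<close>

text \<open>
  A cell is a pair \<open>(S, \<Phi>)\<close>: the characteristic map \<open>\<Phi>\<close> is defined on the closed unit ball of
  a linear subspace \<open>S\<close>, whose dimension is the dimension of the cell. No cell of \<open>M\<close> has
  dimension larger than \<open>CARD('d)\<close>, so subspaces of \<open>real^'d\<close> suffice.
\<close>

type_synonym ('a, 'd) cell = "(real^'d) set \<times> (real^'d \<Rightarrow> 'a)"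

definition cell_dim :: "('a, 'd::finite) cell \<Rightarrow> nat" where
  "cell_dim e = dim (fst e)"

definition open_cell :: "('a, 'd::finite) cell \<Rightarrow> 'a set" where
  "open_cell e = snd e ` (ball 0 1 \<inter> fst e)"

text \<open>
  A CW-decomposition of a compact space has finitely many cells; then closure finiteness and the
  weak topology are automatic.
\<close>

definition cw_decomposition :: "('a::topological_space, 'd::finite) cell set \<Rightarrow> bool" where
  "cw_decomposition K \<longleftrightarrow> finite K \<and>
     (\<Union>e\<in>K. open_cell e) = UNIV \<and>
     (\<forall>e\<in>K. \<forall>e'\<in>K. e \<noteq> e' \<longrightarrow> open_cell e \<inter> open_cell e' = {}) \<and>
     (\<forall>(S, \<Phi>)\<in>K. subspace S \<and> continuous_on (cball 0 1 \<inter> S) \<Phi> \<and>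
        (\<exists>\<Theta>. homeomorphism (ball 0 1 \<inter> S) (\<Phi> ` (ball 0 1 \<inter> S)) \<Phi> \<Theta>) \<and>
        \<Phi> ` (sphere 0 1 \<inter> S) \<subseteq> (\<Union>e\<in>{e\<in>K. cell_dim e < dim S}. open_cell e))"

text \<open>\<open>\<Delta>\<close> is the open top-dimensional cell of a decomposition with only one such cell.\<close>

definition unique_top_cell :: "('a::topological_space, 'd::finite) cell set \<Rightarrow> 'a set \<Rightarrow> bool" where
  "unique_top_cell K \<Delta> \<longleftrightarrow> cw_decomposition K \<and>
     (\<exists>e. {e\<in>K. cell_dim e = CARD('d)} = {e} \<and> \<Delta> = open_cell e)"

definition diffeo_from_ball ::
    "('a::topological_space, 'd::finite) chart set \<Rightarrow> (real^'d \<Rightarrow> 'a) \<Rightarrow> 'a set \<Rightarrow> bool" where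
  "diffeo_from_ball A \<psi> \<Delta> \<longleftrightarrow>
     homeomorphism (ball 0 1) \<Delta> \<psi> (inv_into (ball 0 1) \<psi>) \<and>
     (\<forall>(U, c)\<in>A. smooth_on {v\<in>ball 0 1. \<psi> v \<in> U} (c \<circ> \<psi>) \<and>
        smooth_on (c ` (U \<inter> \<Delta>)) (inv_into (ball 0 1) \<psi> \<circ> inv_into U c))"


section \<open>Homeomorphisms isotopic to the identity\<close>

definition isotopy :: "(real \<Rightarrow> 'a \<Rightarrow> 'a::topological_space) \<Rightarrow> ('a \<Rightarrow> 'a) \<Rightarrow> bool" where
  "isotopy F f \<longleftrightarrow> continuous_on ({0..1} \<times> UNIV) (\<lambda>(t, x). F t x) \<and>
     (\<forall>t\<in>{0..1}. \<exists>g. homeomorphism UNIV UNIV (F t) g) \<and> F 0 = id \<and> F 1 = f"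

definition Homeo0 :: "('a::topological_space, 'd::finite) chart set \<Rightarrow> ('a \<Rightarrow> 'a) monoid" where
  "Homeo0 A = \<lparr>carrier = {f. (\<exists>g. homeomorphism UNIV UNIV f g) \<and>
       (\<exists>W. open W \<and> mboundary A \<subseteq> W \<and> (\<forall>x\<in>W. f x = x)) \<and> (\<exists>F. isotopy F f)},
     mult = (\<circ>), one = id\<rparr>"


section \<open>Quasimorphisms and undistorted elements\<close>

definition quasimorphism :: "('g, 'b) monoid_scheme \<Rightarrow> ('g \<Rightarrow> real) \<Rightarrow> bool" where
  "quasimorphism G \<phi> \<longleftrightarrow>
     (\<exists>D. \<forall>g\<in>carrier G. \<forall>h\<in>carrier G. \<bar>\<phi> h - \<phi> (g \<otimes>\<^bsub>G\<^esub> h) + \<phi> g\<bar> \<le> D)"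

definition homogeneous :: "('g, 'b) monoid_scheme \<Rightarrow> ('g \<Rightarrow> real) \<Rightarrow> bool" where
  "homogeneous G \<phi> \<longleftrightarrow> (\<forall>g\<in>carrier G. \<forall>k::int. \<phi> (g [^]\<^bsub>G\<^esub> k) = of_int k * \<phi> g)"

definition group_center :: "('g, 'b) monoid_scheme \<Rightarrow> 'g set" where
  "group_center G = {g\<in>carrier G. \<forall>h\<in>carrier G. g \<otimes>\<^bsub>G\<^esub> h = h \<otimes>\<^bsub>G\<^esub> g}"

definition generating_set :: "('g, 'b) monoid_scheme \<Rightarrow> 'g set \<Rightarrow> bool" where
  "generating_set G S \<longleftrightarrow> S \<subseteq> carrier G \<and> generate G S = carrier G"

definition word_norm :: "('g, 'b) monoid_scheme \<Rightarrow> 'g set \<Rightarrow> 'g \<Rightarrow> nat" where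
  "word_norm G S g = (LEAST k. \<exists>ws. length ws = k \<and> set ws \<subseteq> S \<union> m_inv G ` S \<and>
     foldr (\<otimes>\<^bsub>G\<^esub>) ws \<one>\<^bsub>G\<^esub> = g)"

definition undistorted_fg :: "('g, 'b) monoid_scheme \<Rightarrow> 'g \<Rightarrow> bool" where
  "undistorted_fg G g \<longleftrightarrow> (\<forall>S. finite S \<and> generating_set G S \<longrightarrow>
     (\<exists>l>0. (\<lambda>k. real (word_norm G S (g [^]\<^bsub>G\<^esub> k)) / real k) \<longlonglongrightarrow> l))"

definition undistorted :: "('g, 'b) monoid_scheme \<Rightarrow> 'g \<Rightarrow> bool" where
  "undistorted G g \<longleftrightarrow> (\<forall>H. subgroup H G \<and> g \<in> H \<and>
     (\<exists>S. finite S \<and> generating_set (G\<lparr>carrier := H\<rparr>) S) \<longrightarrow> undistorted_fg (G\<lparr>carrier := H\<rparr>) g)"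


section \<open>Fundamental groups and pure braid groups\<close>

definition loops_at :: "'x::topological_space set \<Rightarrow> 'x \<Rightarrow> (real \<Rightarrow> 'x) set" where
  "loops_at S z = {p. path p \<and> path_image p \<subseteq> S \<and> pathstart p = z \<and> pathfinish p = z}"

definition path_class :: "'x::topological_space set \<Rightarrow> (real \<Rightarrow> 'x) \<Rightarrow> (real \<Rightarrow> 'x) set" where
  "path_class S p = {q. homotopic_paths S p q}"

text \<open>
  Concatenation is read from right to left, whereas \<open>+++\<close> traverses its left operand first.
\<close>

definition fundamental_group :: "'x::topological_space set \<Rightarrow> 'x \<Rightarrow> (real \<Rightarrow> 'x) set monoid" where
  "fundamental_group S z =
     \<lparr>carrier = path_class S ` loops_at S z,
      mult = (\<lambda>P Q. {r. \<exists>p\<in>P. \<exists>q\<in>Q. homotopic_paths S (q +++ p) r}),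
      one = path_class S (\<lambda>_. z)\<rparr>"

text \<open>The number of points is \<open>CARD('p)\<close>; \<open>M\<^sup>n\<close> is the function space \<open>'p \<Rightarrow> 'a\<close>.\<close>

definition config :: "'a set \<Rightarrow> ('p::finite \<Rightarrow> 'a) set" where
  "config D = {x. inj x \<and> range x \<subseteq> D}"

definition pure_braid_group ::
    "('p::finite \<Rightarrow> 'a::topological_space) \<Rightarrow> (real \<Rightarrow> 'p \<Rightarrow> 'a) set monoid" where
  "pure_braid_group z = fundamental_group (config UNIV) z"

definition local_braids ::
    "'a::topological_space set \<Rightarrow> ('p::finite \<Rightarrow> 'a) \<Rightarrow> (real \<Rightarrow> 'p \<Rightarrow> 'a) set set" where
  "local_braids \<Delta> z = path_class (config UNIV) ` loops_at (config \<Delta>) z"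


section \<open>The braids \<open>\<gamma>(f, x)\<close> and the function \<open>\<Psi>\<close>\<close>

text \<open>The unit speed geodesic from \<open>u\<close> to \<open>v\<close>, which rests at \<open>v\<close> after its arrival.\<close>

definition geodesic :: "'e::euclidean_space \<Rightarrow> 'e \<Rightarrow> real \<Rightarrow> 'e" where
  "geodesic u v s = (if s < dist u v then u + (s / dist u v) *\<^sub>R (v - u) else v)"

text \<open>
  \<open>ell \<psi> y x\<close> is the path from \<open>x\<close> to \<open>y\<close> moving all points along the geodesics of the Euclidean
  metric transported by \<open>\<psi> : ball 0 1 \<rightarrow> \<Delta>\<close>. The common time interval \<open>[0, L]\<close>, where \<open>L\<close> is the
  largest of the lengths, is rescaled to \<open>[0, 1]\<close>.
\<close>

definition ell ::
    "(real^'d::finite \<Rightarrow> 'a) \<Rightarrow> ('p::finite \<Rightarrow> 'a) \<Rightarrow> ('p \<Rightarrow> 'a) \<Rightarrow> real \<Rightarrow> 'p \<Rightarrow> 'a" where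
  "ell \<psi> y x = (let \<theta> = inv_into (ball 0 1) \<psi>; L = Max (range (\<lambda>i. dist (\<theta> (x i)) (\<theta> (y i))))
     in (\<lambda>t i. \<psi> (geodesic (\<theta> (x i)) (\<theta> (y i)) (t * L))))"

text \<open>The geodesics do not collide.\<close>

definition ell_defined ::
    "(real^'d::finite \<Rightarrow> 'a::topological_space) \<Rightarrow> ('p::finite \<Rightarrow> 'a) \<Rightarrow> ('p \<Rightarrow> 'a) \<Rightarrow> bool" where
  "ell_defined \<psi> y x \<longleftrightarrow> path_image (ell \<psi> y x) \<subseteq> config UNIV"

definition gamma ::
    "(real^'d::finite \<Rightarrow> 'a::topological_space) \<Rightarrow> ('p::finite \<Rightarrow> 'a) \<Rightarrow>
      (real \<Rightarrow> 'a \<Rightarrow> 'a) \<Rightarrow> ('p \<Rightarrow> 'a) \<Rightarrow> (real \<Rightarrow> 'p \<Rightarrow> 'a) set" where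
  "gamma \<psi> z F x =
     path_class (config UNIV) (ell \<psi> x z +++ (\<lambda>t. F t \<circ> x) +++ ell \<psi> z (F 1 \<circ> x))"

definition gamma_domain ::
    "'a::topological_space set \<Rightarrow> (real^'d::finite \<Rightarrow> 'a) \<Rightarrow> ('p::finite \<Rightarrow> 'a) \<Rightarrow>
      ('a \<Rightarrow> 'a) \<Rightarrow> ('p \<Rightarrow> 'a) set" where
  "gamma_domain \<Delta> \<psi> z f = {x\<in>config \<Delta>. f \<circ> x \<in> config \<Delta> \<and>
     ell_defined \<psi> x z \<and> ell_defined \<psi> z (f \<circ> x)}"

text \<open>
  \<open>F\<close> is an isotopy from the identity to \<open>F 1\<close>. Where the braid is not defined, the integrand
  is \<open>0\<close>.
\<close>

definition Psi_integral ::
    "'a::topological_space measure \<Rightarrow> 'a set \<Rightarrow> (real^'d::finite \<Rightarrow> 'a) \<Rightarrow> ('p::finite \<Rightarrow> 'a) \<Rightarrow>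
      ((real \<Rightarrow> 'p \<Rightarrow> 'a) set \<Rightarrow> real) \<Rightarrow> (real \<Rightarrow> 'a \<Rightarrow> 'a) \<Rightarrow> real" where
  "Psi_integral \<mu> \<Delta> \<psi> z \<phi> F =
     (LINT x:config UNIV|Pi\<^sub>M UNIV (\<lambda>_. \<mu>).
        if x \<in> gamma_domain \<Delta> \<psi> z (F 1) then \<phi> (gamma \<psi> z F x) else 0)"

end

theory Submission
  imports Defs "HOL-Probability.Infinite_Product_Measure"
begin

text \<open>
  Choosing tails from \<open>z\<close> turns \<open>\<phi>\<close> into a real-valued function \<open>val\<close> of all paths in the
  configuration space; it is additive up to a constant and vanishes on paths in the configurations
  of \<open>\<Delta>\<close>. Every tuple of points of \<open>M\<close>, with repetitions allowed, has a product neighbourhood of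
  coordinate half-balls, any two equal or disjoint, that can be shrunk within themselves into the
  dense set \<open>\<Delta>\<close>. So \<open>val\<close> vanishes on the loops at a base point in each of these neighbourhoods.
  Compactness of \<open>M\<^sup>n\<close> leaves finitely many of them. Measuring a configuration by \<open>val\<close> of a path to
  it from such a base point gives a function \<open>b\<close> with the property that, for each isotopy from the
  identity to \<open>g\<close>, \<open>val\<close> of the track of \<open>x\<close> differs from \<open>b (g x) - b x\<close> by a bounded amount;
  and \<open>b\<close> is bounded on the configurations of \<open>\<Delta>\<close>. Two isotopies with the same end differ by
  central loops, so these defects add up along words. Hence \<open>\<phi> (\<gamma>(f, x))\<close> is bounded by a multiple
  of the word length of \<open>f\<close>, uniformly in \<open>x\<close>. No intermediate configuration has to lie in \<open>\<Delta>\<close>, which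
  matters because homeomorphisms need not preserve null sets.
\<close>

section \<open>Paths and homotopies\<close>

text \<open>A bound on \<phi> has to be uniform up to the missing diagonals of M^n, where several
  strands can twist around each other arbitrarily often. Such twisting takes place among points of a
  common half-ball, hence, after shrinking, in \<Delta>, where \<phi> does not see it. For this
  reason the half-balls of repeated entries must coincide and be shrunk by one and the same
  embedding, never to a point. In the language of cocycles, the values of tracks form a cocycle of
  the homeomorphisms up to a bounded error, and b is a primitive of it, with an error that depends
  on the homeomorphism but not on the configuration. Along a word the intermediate values of b
  telescope. Only those at x and f x survive, and wherever \<gamma>(f, x) is defined both
  configurations lie in \<Delta>.\<close>

lemma homotopic_paths_square_image:
  fixes K :: "real \<Rightarrow> real \<Rightarrow> 'x::topological_space"
  assumes K: "continuous_on ({0..1} \<times> {0..1}) (\<lambda>(s, t). K s t)"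
    and KS: "\<And>s t. s \<in> {0..1} \<Longrightarrow> t \<in> {0..1} \<Longrightarrow> K s t \<in> S"
    and u: "path u" "path_image u \<subseteq> {0..1} \<times> {0..1}"
    and v: "path v" "path_image v \<subseteq> {0..1} \<times> {0..1}"
    and ends: "pathstart v = pathstart u" "pathfinish v = pathfinish u"
  shows "homotopic_paths S ((\<lambda>(s, t). K s t) \<circ> u) ((\<lambda>(s, t). K s t) \<circ> v)"
proof (rule homotopic_paths_continuous_image[OF _ K])
  \<comment> \<open>The straight-line homotopy from u to v stays in the convex square, and K carries
    it into S.\<close>
  have conv: "convex ({0..1::real} \<times> {0..1::real})"
    by (intro convex_Times) auto
  show "homotopic_paths ({0..1} \<times> {0..1}) u v"
  proof (rule homotopic_paths_linear)
    fix t :: real assume "t \<in> {0..1}"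
    then have "u t \<in> {0..1} \<times> {0..1}" "v t \<in> {0..1} \<times> {0..1}"
      using u v unfolding path_image_def by blast+
    then show "closed_segment (u t) (v t) \<subseteq> {0..1} \<times> {0..1}"
      using conv by (meson closed_segment_subset)
  qed (use u v ends in auto)
  show "(\<lambda>(s, t). K s t) \<in> {0..1} \<times> {0..1} \<rightarrow> S"
    using KS by auto
qed

text \<open>Images of routes from (0, 0) to (1, 1) in the square. The edge form will move a path
  across a flow; the diagonal form will compare a composed isotopy with a concatenation.\<close>

lemma
  fixes K :: "real \<Rightarrow> real \<Rightarrow> 'x::topological_space"
  assumes K: "continuous_on ({0..1} \<times> {0..1}) (\<lambda>(s, t). K s t)"
    and KS: "\<And>s t. s \<in> {0..1} \<Longrightarrow> t \<in> {0..1} \<Longrightarrow> K s t \<in> S"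
  shows homotopic_paths_square:
      "homotopic_paths S ((\<lambda>s. K s 0) +++ (\<lambda>t. K 1 t)) ((\<lambda>t. K 0 t) +++ (\<lambda>s. K s 1))"
    and homotopic_paths_diagonal:
      "homotopic_paths S (\<lambda>s. K s s) ((\<lambda>s. K s 0) +++ (\<lambda>t. K 1 t))"
proof -
  let ?e = "\<lambda>a b. linepath a b :: real \<Rightarrow> real \<times> real"
  have sub: "path_image (?e a b) \<subseteq> {0..1} \<times> {0..1}"
    if "a \<in> {0..1} \<times> {0..1}" "b \<in> {0..1} \<times> {0..1}" for a b
    unfolding path_image_linepath
    by (rule closed_segment_subset[OF that]) (intro convex_Times; auto)
  have eq: "(\<lambda>(s, t). K s t) \<circ> ?e (0, 0) (1, 0) = (\<lambda>s. K s 0)"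
    "(\<lambda>(s, t). K s t) \<circ> ?e (1, 0) (1, 1) = (\<lambda>t. K 1 t)"
    "(\<lambda>(s, t). K s t) \<circ> ?e (0, 0) (0, 1) = (\<lambda>t. K 0 t)"
    "(\<lambda>(s, t). K s t) \<circ> ?e (0, 1) (1, 1) = (\<lambda>s. K s 1)"
    "(\<lambda>(s, t). K s t) \<circ> ?e (0, 0) (1, 1) = (\<lambda>s. K s s)"
    by (auto simp: linepath_def fun_eq_iff)
  have "homotopic_paths S ((\<lambda>(s, t). K s t) \<circ> (?e (0, 0) (1, 0) +++ ?e (1, 0) (1, 1)))
      ((\<lambda>(s, t). K s t) \<circ> (?e (0, 0) (0, 1) +++ ?e (0, 1) (1, 1)))"
    by (rule homotopic_paths_square_image[OF K KS])
       (simp_all del: path_image_linepath add: subset_path_image_join sub)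
  then show "homotopic_paths S ((\<lambda>s. K s 0) +++ (\<lambda>t. K 1 t)) ((\<lambda>t. K 0 t) +++ (\<lambda>s. K s 1))"
    unfolding path_compose_join eq .
  have "homotopic_paths S ((\<lambda>(s, t). K s t) \<circ> ?e (0, 0) (1, 1))
      ((\<lambda>(s, t). K s t) \<circ> (?e (0, 0) (1, 0) +++ ?e (1, 0) (1, 1)))"
    by (rule homotopic_paths_square_image[OF K KS])
       (simp_all del: path_image_linepath add: subset_path_image_join sub)
  then show "homotopic_paths S (\<lambda>s. K s s) ((\<lambda>s. K s 0) +++ (\<lambda>t. K 1 t))"
    unfolding path_compose_join eq .
qed

text \<open>The endpoints are explicit arguments, so that the groupoid laws below can be chained by
  unification.\<close>

definition path_in :: "'x::topological_space set \<Rightarrow> 'x \<Rightarrow> 'x \<Rightarrow> (real \<Rightarrow> 'x) \<Rightarrow> bool" where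
  "path_in S x y p \<longleftrightarrow> path p \<and> path_image p \<subseteq> S \<and> pathstart p = x \<and> pathfinish p = y"

lemma path_in_join: "path_in S x y p \<Longrightarrow> path_in S y w q \<Longrightarrow> path_in S x w (p +++ q)"
  unfolding path_in_def by (auto simp: path_image_join)

lemma path_in_reverse: "path_in S x y p \<Longrightarrow> path_in S y x (reversepath p)"
  unfolding path_in_def by auto

lemma path_in_mono: "path_in S x y p \<Longrightarrow> S \<subseteq> T \<Longrightarrow> path_in T x y p"
  unfolding path_in_def by auto

lemma path_in_const: "x \<in> S \<Longrightarrow> path_in S x x (\<lambda>_. x)"
  unfolding path_in_def path_def path_image_def pathstart_def pathfinish_def by auto

lemma path_connected_path_in: "path_connected S \<longleftrightarrow> (\<forall>x\<in>S. \<forall>y\<in>S. \<exists>p. path_in S x y p)"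
  unfolding path_connected_def path_in_def by auto

lemma loops_at_path_in: "p \<in> loops_at S z \<longleftrightarrow> path_in S z z p"
  unfolding loops_at_def path_in_def by auto

lemma path_in_homotopic:
  assumes "homotopic_paths S p q" "path_in S x y p" shows "path_in S x y q"
  using assms homotopic_paths_imp_path homotopic_paths_imp_subset
    homotopic_paths_imp_pathstart homotopic_paths_imp_pathfinish
  unfolding path_in_def by metis

lemma path_in_homotopic_eq:
  assumes "path_in S x y p" "\<And>t. t \<in> {0..1} \<Longrightarrow> p t = q t"
  shows "homotopic_paths S p q"
  using assms unfolding path_in_def by (intro homotopic_paths_eq) auto

lemma path_in_image:
  "path_in S x y p \<Longrightarrow> continuous_on S f \<Longrightarrow> f ` S \<subseteq> T \<Longrightarrow> path_in T (f x) (f y) (f \<circ> p)"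
  unfolding path_in_def
  by (auto simp: pathstart_compose pathfinish_compose path_image_compose
      intro!: path_continuous_image elim: continuous_on_subset)

lemma path_class_eq_iff:
  assumes "path_in S x y p"
  shows "path_class S p = path_class S q \<longleftrightarrow> homotopic_paths S p q"
proof
  assume "path_class S p = path_class S q"
  moreover have "p \<in> path_class S p"
    using assms unfolding path_class_def path_in_def by simp
  ultimately show "homotopic_paths S p q"
    unfolding path_class_def by (simp add: homotopic_paths_sym)
next
  assume "homotopic_paths S p q"
  then show "path_class S p = path_class S q"
    unfolding path_class_def
    by (auto intro: homotopic_paths_trans homotopic_paths_sym)
qed

text \<open>The set-valued product is a single class because homotopy respects joins. The factors
  swap, since \<open>+++\<close> runs its left operand first while products are read from right to
  left.\<close>

lemma fundamental_group_mult:
  assumes p: "path_in S z z p" and q: "path_in S z z q"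
  shows "path_class S p \<otimes>\<^bsub>fundamental_group S z\<^esub> path_class S q = path_class S (q +++ p)"
proof -
  have "homotopic_paths S (q +++ p) r"
    if "homotopic_paths S p p'" "homotopic_paths S q q'" "homotopic_paths S (q' +++ p') r" for p' q' r
    using homotopic_paths_trans[OF homotopic_paths_join[OF that(2,1)] that(3)] p q
    unfolding path_in_def by auto
  moreover have "homotopic_paths S p p" "homotopic_paths S q q"
    using p q unfolding path_in_def by auto
  ultimately have "{r. \<exists>p'\<in>path_class S p. \<exists>q'\<in>path_class S q. homotopic_paths S (q' +++ p') r} =
      path_class S (q +++ p)"
    unfolding path_class_def by blast
  then show ?thesis
    unfolding fundamental_group_def by simp
qed

lemma fundamental_group_carrier:
  "g \<in> carrier (fundamental_group S z) \<longleftrightarrow> (\<exists>p. path_in S z z p \<and> g = path_class S p)"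
  unfolding fundamental_group_def by (auto simp: loops_at_path_in)

lemma homotopic_assoc:
  "path_in S a b p \<Longrightarrow> path_in S b c q \<Longrightarrow> path_in S c d r \<Longrightarrow>
    homotopic_paths S (p +++ (q +++ r)) ((p +++ q) +++ r)"
  unfolding path_in_def by (intro homotopic_paths_assoc) auto

lemma homotopic_join:
  "homotopic_paths S p p' \<Longrightarrow> homotopic_paths S q q' \<Longrightarrow> path_in S a b p \<Longrightarrow> path_in S b c q \<Longrightarrow>
    homotopic_paths S (p +++ q) (p' +++ q')"
  unfolding path_in_def by (intro homotopic_paths_join) auto

lemma homotopic_refl: "path_in S a b p \<Longrightarrow> homotopic_paths S p p"
  unfolding path_in_def by auto

text \<open>The unit and inverse laws hold in the interval for the segment from 0 to 1; p carries
  them to an arbitrary space, where straight segments make no sense.\<close>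

lemma
  assumes p: "path_in S a b p"
  shows homotopic_rid: "homotopic_paths S (p +++ (\<lambda>_. b)) p"
    and homotopic_lid: "homotopic_paths S ((\<lambda>_. a) +++ p) p"
    and homotopic_rinv: "homotopic_paths S (p +++ reversepath p) (\<lambda>_. a)"
proof -
  let ?e = "\<lambda>a b. linepath a b :: real \<Rightarrow> real"
  have p': "continuous_on {0..1} p" "p \<in> {0..1} \<rightarrow> S" "p 0 = a" "p 1 = b"
    using p unfolding path_in_def path_def path_image_def pathstart_def pathfinish_def by auto
  have e: "p \<circ> ?e 0 1 = p" "p \<circ> ?e 1 1 = (\<lambda>_. b)" "p \<circ> ?e 0 0 = (\<lambda>_. a)"
    "p \<circ> reversepath (?e 0 1) = reversepath p"
    using p' by (auto simp: linepath_def fun_eq_iff reversepath_def)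
  have i: "path (?e 0 1)" "path_image (?e 0 1) \<subseteq> {0..1}" "pathstart (?e 0 1) = 0" "pathfinish (?e 0 1) = 1"
    by (auto simp: closed_segment_eq_real_ivl)
  note im = homotopic_paths_continuous_image[OF _ p'(1,2)]
  show "homotopic_paths S (p +++ (\<lambda>_. b)) p" "homotopic_paths S ((\<lambda>_. a) +++ p) p"
    "homotopic_paths S (p +++ reversepath p) (\<lambda>_. a)"
    using im[OF homotopic_paths_rid[OF i(1,2)]] im[OF homotopic_paths_lid[OF i(1,2)]]
      im[OF homotopic_paths_rinv[OF i(1,2)]]
    unfolding path_compose_join i e by auto
qed

lemma homotopic_cancel_left:
  assumes "path_in S a b p" "path_in S a c q"
  shows "homotopic_paths S (p +++ (reversepath p +++ q)) q"
proof -
  have "homotopic_paths S (p +++ (reversepath p +++ q)) ((p +++ reversepath p) +++ q)"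
    using assms by (intro homotopic_assoc path_in_reverse)
  also have "homotopic_paths S \<dots> ((\<lambda>_. a) +++ q)"
    using assms by (intro homotopic_join homotopic_rinv homotopic_refl path_in_join path_in_reverse)
  also have "homotopic_paths S \<dots> q"
    using assms by (intro homotopic_lid)
  finally show ?thesis .
qed

lemma homotopic_cancel_right:
  assumes "path_in S a b p" "path_in S b c q"
  shows "homotopic_paths S (reversepath p +++ (p +++ q)) q"
  using homotopic_cancel_left[of S b a "reversepath p" c q] assms path_in_reverse by force

lemma homotopic_cancel_middle:
  assumes p: "path_in S a b p" and q: "path_in S c b q" and r: "path_in S b d r"
  shows "homotopic_paths S ((p +++ reversepath q) +++ (q +++ r)) (p +++ r)"
proof -
  have "homotopic_paths S ((p +++ reversepath q) +++ (q +++ r)) (p +++ (reversepath q +++ (q +++ r)))"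
    using assms by (intro homotopic_paths_sym[OF homotopic_assoc] path_in_reverse path_in_join)
  also have "homotopic_paths S \<dots> (p +++ r)"
    using assms by (intro homotopic_join homotopic_cancel_right homotopic_refl path_in_join path_in_reverse)
  finally show ?thesis .
qed

section \<open>Quasimorphisms as functions of paths\<close>

text \<open>Abstract setting: C stands for the configurations of the manifold, L for those of
  \<Delta>, and D for the defect of \<phi>.\<close>

locale local_quasimorphism =
  fixes C L :: "'x::topological_space set" and z :: 'x and \<phi> :: "(real \<Rightarrow> 'x) set \<Rightarrow> real" and D :: real
  assumes L_subset: "L \<subseteq> C" and z_in: "z \<in> L"
    and L_connected: "path_connected L" and C_connected: "path_connected C"
    and quasi: "\<And>g h. g \<in> carrier (fundamental_group C z) \<Longrightarrow> h \<in> carrier (fundamental_group C z) \<Longrightarrow>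
      \<bar>\<phi> h - \<phi> (g \<otimes>\<^bsub>fundamental_group C z\<^esub> h) + \<phi> g\<bar> \<le> D"
    and center: "\<And>b. b \<in> group_center (fundamental_group C z) \<Longrightarrow> \<phi> b = 0"
    and local: "\<And>p. path_in L z z p \<Longrightarrow> \<phi> (path_class C p) = 0"
begin

text \<open>For x in L the tail is chosen inside L. This lets a path in L close up to a loop in L,
  where \<phi> vanishes.\<close>

definition tail :: "'x \<Rightarrow> real \<Rightarrow> 'x" where
  "tail x = (SOME p. path_in (if x \<in> L then L else C) z x p)"

lemma tail_in: assumes "x \<in> C" shows "path_in (if x \<in> L then L else C) z x (tail x)"
proof -
  have "\<exists>p. path_in (if x \<in> L then L else C) z x p"
    using L_connected C_connected z_in L_subset assms unfolding path_connected_path_in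
    by (simp add: subset_iff)
  then show ?thesis
    unfolding tail_def by (rule someI_ex)
qed

lemma tail_L: "x \<in> L \<Longrightarrow> path_in L z x (tail x)"
  using tail_in[of x] L_subset by (simp add: subset_iff)

lemma tail: "x \<in> C \<Longrightarrow> path_in C z x (tail x)"
  using tail_in[of x] path_in_mono[OF tail_L L_subset, of x] by (simp split: if_splits)

definition closing :: "(real \<Rightarrow> 'x) \<Rightarrow> real \<Rightarrow> 'x" where
  "closing p = (tail (pathstart p) +++ p) +++ reversepath (tail (pathfinish p))"

definition val :: "(real \<Rightarrow> 'x) \<Rightarrow> real" where
  "val p = \<phi> (path_class C (closing p))"

lemma closing_eq: "path_in S x y p \<Longrightarrow> closing p = (tail x +++ p) +++ reversepath (tail y)"
  unfolding closing_def path_in_def by auto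

lemma path_in_points: "path_in S x y p \<Longrightarrow> x \<in> S \<and> y \<in> S"
  unfolding path_in_def path_image_def pathstart_def pathfinish_def by auto

lemma path_in_closing:
  assumes "path_in C x y p" shows "path_in C z z (closing p)"
proof -
  have "x \<in> C" "y \<in> C" using path_in_points[OF assms] by auto
  then show ?thesis
    unfolding closing_eq[OF assms]
    by (rule path_in_join[OF path_in_join[OF tail assms] path_in_reverse[OF tail]])
qed

lemma quasi_paths:
  assumes "path_in C z z p" "path_in C z z q"
  shows "\<bar>\<phi> (path_class C (p +++ q)) - \<phi> (path_class C p) - \<phi> (path_class C q)\<bar> \<le> D"
proof -
  have "path_class C q \<in> carrier (fundamental_group C z)" "path_class C p \<in> carrier (fundamental_group C z)"
    using assms unfolding fundamental_group_carrier by blast+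
  from quasi[OF this] show ?thesis
    using assms by (simp add: fundamental_group_mult)
qed

lemma phi_homotopic: "path_in S x y p \<Longrightarrow> homotopic_paths C p q \<Longrightarrow> \<phi> (path_class C p) = \<phi> (path_class C q)"
  using path_in_homotopic path_class_eq_iff homotopic_paths_imp_path homotopic_paths_imp_subset
  by (metis path_in_def)

lemma closing_homotopic:
  assumes "path_in C x y p" "homotopic_paths C p q"
  shows "homotopic_paths C (closing p) (closing q)"
proof -
  have q: "path_in C x y q"
    using path_in_homotopic assms by metis
  have "x \<in> C" "y \<in> C" using path_in_points[OF assms(1)] by auto
  note t = tail[OF this(1)] path_in_reverse[OF tail[OF this(2)]]
  show ?thesis
    unfolding closing_eq[OF assms(1)] closing_eq[OF q]
    by (rule homotopic_join[OF homotopic_join[OF homotopic_refl[OF t(1)] assms(2) t(1) assms(1)]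
          homotopic_refl[OF t(2)] path_in_join[OF t(1) assms(1)] t(2)])
qed

text \<open>The tail to y and its reverse cancel in the middle.\<close>

lemma closing_join:
  assumes p: "path_in C x y p" and q: "path_in C y w q"
  shows "homotopic_paths C (closing p +++ closing q) (closing (p +++ q))"
proof -
  have pts: "x \<in> C" "y \<in> C" "w \<in> C"
    using path_in_points p q by auto
  note tx = tail[OF pts(1)] and ty = tail[OF pts(2)] and tw = path_in_reverse[OF tail[OF pts(3)]]
  note a = path_in_join[OF tx p] path_in_join[OF q tw]
  have "homotopic_paths C (closing p +++ closing q)
      (closing p +++ (tail y +++ (q +++ reversepath (tail w))))"
    unfolding closing_eq[OF q]
    by (rule homotopic_join[OF homotopic_refl[OF path_in_closing[OF p]]
          homotopic_paths_sym[OF homotopic_assoc[OF ty q tw]] path_in_closing[OF p]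
          path_in_join[OF path_in_join[OF ty q] tw]])
  also have "homotopic_paths C \<dots> ((tail x +++ p) +++ (q +++ reversepath (tail w)))"
    unfolding closing_eq[OF p] by (rule homotopic_cancel_middle[OF a(1) ty a(2)])
  also have "homotopic_paths C \<dots> (((tail x +++ p) +++ q) +++ reversepath (tail w))"
    by (rule homotopic_assoc[OF a(1) q tw])
  also have "homotopic_paths C \<dots> (closing (p +++ q))"
    unfolding closing_eq[OF path_in_join[OF p q]]
    by (rule homotopic_join[OF homotopic_paths_sym[OF homotopic_assoc[OF tx p q]] homotopic_refl[OF tw]
          path_in_join[OF a(1) q] tw])
  finally show ?thesis .
qed

lemma val_homotopic:
  assumes "homotopic_paths C p q" shows "val p = val q"
proof -
  have p: "path_in C (pathstart p) (pathfinish p) p"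
    using assms homotopic_paths_imp_path homotopic_paths_imp_subset unfolding path_in_def by metis
  show ?thesis
    unfolding val_def using phi_homotopic[OF path_in_closing[OF p] closing_homotopic[OF p assms]] .
qed

lemma val_join:
  assumes p: "path_in C x y p" and q: "path_in C y w q"
  shows "\<bar>val (p +++ q) - val p - val q\<bar> \<le> D"
  using quasi_paths[OF path_in_closing[OF p] path_in_closing[OF q]]
    phi_homotopic[OF path_in_join[OF path_in_closing[OF p] path_in_closing[OF q]] closing_join[OF p q]]
  unfolding val_def by simp

lemma val_local:
  assumes "path_in L x y p" shows "val p = 0"
proof -
  have "x \<in> L" "y \<in> L" using path_in_points[OF assms] by auto
  then show ?thesis
    unfolding val_def closing_eq[OF assms]
    by (rule local[OF path_in_join[OF path_in_join[OF tail_L assms] path_in_reverse[OF tail_L]]])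
qed

lemma D_nonneg: "0 \<le> D"
  using val_join[of z z "\<lambda>_. z" z "\<lambda>_. z"] z_in L_subset path_in_const[of z C] by auto

text \<open>Closing a loop at z only adds \<open>tail z\<close> and its reverse, both in L and hence
  of value 0; the two joins cost D each.\<close>

lemma val_base: "path_in C z z p \<Longrightarrow> \<bar>val p - \<phi> (path_class C p)\<bar> \<le> 2 * D"
proof -
  assume p: "path_in C z z p"
  have t: "path_in L z z (tail z)" using tail_L z_in by auto
  then have tC: "path_in C z z (tail z)" using L_subset path_in_mono by blast
  have "\<phi> (path_class C (tail z)) = 0" "\<phi> (path_class C (reversepath (tail z))) = 0"
    using t by (auto intro: local path_in_reverse)
  then show ?thesis
    using quasi_paths[OF path_in_join[OF tC p] path_in_reverse[OF tC]] quasi_paths[OF tC p]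
    unfolding val_def closing_eq[OF p] by linarith
qed

lemma val_const: "x \<in> C \<Longrightarrow> val (\<lambda>_. x) = 0"
proof -
  assume x: "x \<in> C"
  have "homotopic_paths C (closing (\<lambda>_. x)) (tail x +++ reversepath (tail x))"
    unfolding closing_eq[OF path_in_const[OF x]]
    by (rule homotopic_join[OF homotopic_rid[OF tail[OF x]] homotopic_refl[OF path_in_reverse[OF tail[OF x]]]
          path_in_join[OF tail[OF x] path_in_const[OF x]] path_in_reverse[OF tail[OF x]]])
  also have "homotopic_paths C \<dots> (\<lambda>_. z)"
    using tail[OF x] by (rule homotopic_rinv)
  finally have "val (\<lambda>_. x) = \<phi> (path_class C (\<lambda>_. z))"
    unfolding val_def by (rule phi_homotopic[OF path_in_closing[OF path_in_const[OF x]]])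
  then show ?thesis
    using local[OF path_in_const[OF z_in]] by simp
qed

lemma val_reverse:
  assumes "path_in C x y p" shows "\<bar>val p + val (reversepath p)\<bar> \<le> D"
proof -
  have "val (p +++ reversepath p) = 0"
    using val_homotopic[OF homotopic_rinv[OF assms]] val_const path_in_points[OF assms] by auto
  then show ?thesis
    using val_join[OF assms path_in_reverse[OF assms]] by simp
qed

text \<open>Conjugation with \<open>tail x\<close> identifies the loops at x with those at z, so
  commuting with every loop at x makes the closing of p a central class.\<close>

lemma val_central:
  assumes p: "path_in C x x p"
    and comm: "\<And>q. path_in C x x q \<Longrightarrow> homotopic_paths C (q +++ p) (p +++ q)"
  shows "val p = 0"
proof -
  have x: "x \<in> C" using path_in_points p by auto
  let ?t = "tail x" and ?t' = "reversepath (tail x)"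
  have t: "path_in C z x ?t" "path_in C x z ?t'"
    by (rule tail[OF x], rule path_in_reverse[OF tail[OF x]])
  have "homotopic_paths C (b +++ closing p) (closing p +++ b)" if b: "path_in C z z b" for b
  proof -
    \<comment> \<open>b moved to the base point x. Its closing is b again up to homotopy, so
      commuting with \<open>?q\<close> can be read off at z.\<close>
    let ?q = "?t' +++ (b +++ ?t)"
    note bt = path_in_join[OF b t(1)]
    note q = path_in_join[OF t(2) bt]
    have "homotopic_paths C (closing ?q) ((b +++ ?t) +++ ?t')"
      unfolding closing_eq[OF q]
      by (rule homotopic_join[OF homotopic_cancel_left[OF t(1) bt] homotopic_refl[OF t(2)] path_in_join[OF t(1) q] t(2)])
    also have "homotopic_paths C \<dots> (b +++ (?t +++ ?t'))"
      by (rule homotopic_paths_sym[OF homotopic_assoc[OF b t]])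
    also have "homotopic_paths C \<dots> (b +++ (\<lambda>_. z))"
      by (rule homotopic_join[OF homotopic_refl[OF b] homotopic_rinv[OF t(1)] b path_in_join[OF t]])
    also have "homotopic_paths C \<dots> b"
      by (rule homotopic_rid[OF b])
    finally have bq: "homotopic_paths C (closing ?q) b" .
    note cp = path_in_closing[OF p] and cq = path_in_closing[OF q]
    have "homotopic_paths C (b +++ closing p) (closing ?q +++ closing p)"
      by (rule homotopic_join[OF homotopic_paths_sym[OF bq] homotopic_refl[OF cp] b cp])
    also have "homotopic_paths C \<dots> (closing (?q +++ p))"
      by (rule closing_join[OF q p])
    also have "homotopic_paths C \<dots> (closing (p +++ ?q))"
      by (rule closing_homotopic[OF path_in_join[OF q p] comm[OF q]])
    also have "homotopic_paths C \<dots> (closing p +++ closing ?q)"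
      by (rule homotopic_paths_sym[OF closing_join[OF p q]])
    also have "homotopic_paths C \<dots> (closing p +++ b)"
      by (rule homotopic_join[OF homotopic_refl[OF cp] bq cp cq])
    finally show ?thesis .
  qed
  then have "path_class C (b +++ closing p) = path_class C (closing p +++ b)" if "path_in C z z b" for b
    using path_class_eq_iff[OF path_in_join[OF that path_in_closing[OF p]]] that by blast
  then have "path_class C (closing p) \<otimes>\<^bsub>fundamental_group C z\<^esub> h = h \<otimes>\<^bsub>fundamental_group C z\<^esub> path_class C (closing p)"
    if "h \<in> carrier (fundamental_group C z)" for h
    using that path_in_closing[OF p] by (auto simp: fundamental_group_mult fundamental_group_carrier)
  then have "path_class C (closing p) \<in> group_center (fundamental_group C z)"
    unfolding group_center_def using path_in_closing[OF p] fundamental_group_carrier by blast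
  then show ?thesis
    unfolding val_def by (rule center)
qed

end

section \<open>Flows on a space and the tracks of its points\<close>

definition flow :: "'x::topological_space set \<Rightarrow> (real \<Rightarrow> 'x \<Rightarrow> 'x) \<Rightarrow> bool" where
  "flow C h \<longleftrightarrow> continuous_on ({0..1} \<times> C) (\<lambda>(t, x). h t x) \<and>
     (\<forall>t\<in>{0..1}. \<forall>x\<in>C. h t x \<in> C) \<and> (\<forall>x\<in>C. h 0 x = x)"

lemma continuous_on_Times_compose:
  assumes h: "continuous_on (S \<times> T) (\<lambda>(t, x). h t x)"
    and u: "continuous_on U u" "u ` U \<subseteq> S" and v: "continuous_on U v" "v ` U \<subseteq> T"
  shows "continuous_on U (\<lambda>a. h (u a) (v a))"
  using continuous_on_compose2[OF h continuous_on_Pair[OF u(1) v(1)]] u(2) v(2) by force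

lemma continuous_on_Times_section:
  "continuous_on (S \<times> T) (\<lambda>(t, x). h t x) \<Longrightarrow> x \<in> T \<Longrightarrow> continuous_on S (\<lambda>t. h t x)"
  "continuous_on (S \<times> T) (\<lambda>(t, x). h t x) \<Longrightarrow> t \<in> S \<Longrightarrow> continuous_on T (\<lambda>x. h t x)"
  by (rule continuous_on_Times_compose, assumption; auto)+

lemma track_path:
  assumes "continuous_on ({0..1} \<times> R) (\<lambda>(t, x). h t x)" "\<And>t x. t \<in> {0..1} \<Longrightarrow> x \<in> R \<Longrightarrow> h t x \<in> C"
    and "x \<in> R"
  shows "path_in C (h 0 x) (h 1 x) (\<lambda>t. h t x)"
  using continuous_on_Times_section(1)[OF assms(1,3)] assms(2,3)
  unfolding path_in_def path_def path_image_def pathstart_def pathfinish_def by auto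

text \<open>Naturality of tracks: the square \<open>h t (q s)\<close> is bounded by the images of q
  under the first and the last map and by the tracks of a and b.\<close>

lemma track_exchange:
  fixes h :: "real \<Rightarrow> 'y::topological_space \<Rightarrow> 'x::topological_space"
  assumes h: "continuous_on ({0..1} \<times> R) (\<lambda>(t, x). h t x)" "\<And>t x. t \<in> {0..1} \<Longrightarrow> x \<in> R \<Longrightarrow> h t x \<in> C"
    and q: "path_in R a b q"
  shows "homotopic_paths C ((h 0 \<circ> q) +++ (\<lambda>t. h t b)) ((\<lambda>t. h t a) +++ (h 1 \<circ> q))"
proof -
  have q': "continuous_on {0..1} q" "q ` {0..1} \<subseteq> R" "q 0 = a" "q 1 = b"
    using q unfolding path_in_def path_def path_image_def pathstart_def pathfinish_def by auto
  have "continuous_on ({0..1} \<times> {0..1}) (\<lambda>y. h (snd y) (q (fst y)))"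
  proof (rule continuous_on_Times_compose[OF h(1)])
    show "continuous_on ({0..1} \<times> {0..1::real}) (\<lambda>y. q (fst y))"
      by (rule continuous_on_compose2[OF q'(1)]) (auto intro!: continuous_intros)
  qed (use q' in \<open>auto intro!: continuous_intros\<close>)
  then have "continuous_on ({0..1} \<times> {0..1}) (\<lambda>(s, t). h t (q s))"
    by (simp add: case_prod_unfold)
  then have "homotopic_paths C ((\<lambda>s. h 0 (q s)) +++ (\<lambda>t. h t (q 1))) ((\<lambda>t. h t (q 0)) +++ (\<lambda>s. h 1 (q s)))"
    using h(2) q'(2) by (intro homotopic_paths_square) (auto simp: image_subset_iff)
  then show ?thesis
    using q'(3,4) by (simp add: comp_def)
qed

context local_quasimorphism
begin

text \<open>\<open>val\<close> does not see the loops of S at y, hence the value of a path in S from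
  y is determined by its end up to a multiple of D.\<close>

definition admissible :: "'x set \<Rightarrow> 'x \<Rightarrow> bool" where
  "admissible S y \<longleftrightarrow> S \<subseteq> C \<and> path_connected S \<and> y \<in> S \<and> (\<forall>q. path_in S y y q \<longrightarrow> val q = 0)"

lemma admissible_L: "admissible L z"
  unfolding admissible_def using L_subset L_connected z_in val_local by auto

text \<open>Running along p and back over q and p0 closes a loop of value 0; two joins and two
  reversals cost D each.\<close>

lemma admissible_val:
  assumes S: "admissible S y" and p: "path_in S y r p" and p0: "path_in S y r0 p0" and q: "path_in S r0 r q"
  shows "\<bar>val p - val q - val p0\<bar> \<le> 4 * D"
proof -
  have SC: "S \<subseteq> C" using S unfolding admissible_def by auto
  have "path_in S y y (p +++ (reversepath q +++ reversepath p0))"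
    by (rule path_in_join[OF p path_in_join[OF path_in_reverse[OF q] path_in_reverse[OF p0]]])
  then have "val (p +++ (reversepath q +++ reversepath p0)) = 0"
    using S unfolding admissible_def by auto
  moreover have "path_in C y r p" "path_in C y r0 p0" "path_in C r0 r q"
    using path_in_mono[OF _ SC] p p0 q by blast+
  note this = this path_in_reverse[OF this(2)] path_in_reverse[OF this(3)]
  note val_join[OF this(1) path_in_join[OF this(5,4)]] val_join[OF this(5,4)]
    val_reverse[OF this(2)] val_reverse[OF this(3)]
  ultimately show ?thesis
    by linarith
qed

text \<open>Comparison with one reference point r0: a path q in R from r0 to r, transported by the
  flow, links the defects at r and r0. Loops of R do no harm, because q runs in S and its image in
  S', and both are admissible.\<close>

lemma transition_bounded:
  assumes S: "admissible S y" and S': "admissible S' y'" and R: "path_connected R" "R \<subseteq> S"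
    and h: "continuous_on ({0..1} \<times> R) (\<lambda>(t, x). h t x)" "\<And>t x. t \<in> {0..1} \<Longrightarrow> x \<in> R \<Longrightarrow> h t x \<in> C"
    and h0: "\<And>x. x \<in> R \<Longrightarrow> h 0 x = x" and h1: "\<And>x. x \<in> R \<Longrightarrow> h 1 x \<in> S'"
  shows "\<exists>K. \<forall>r\<in>R. \<forall>p p'. path_in S y r p \<longrightarrow> path_in S' y' (h 1 r) p' \<longrightarrow>
    \<bar>val p + val (\<lambda>t. h t r) - val p'\<bar> \<le> K"
proof (cases "R = {}")
  case False
  then obtain r0 where r0: "r0 \<in> R" by auto
  have "y \<in> S" "r0 \<in> S" "path_connected S" using S R r0 unfolding admissible_def by auto
  then obtain p0 where p0: "path_in S y r0 p0"
    unfolding path_connected_path_in by blast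
  have "y' \<in> S'" "h 1 r0 \<in> S'" "path_connected S'" using S' h1 r0 unfolding admissible_def by auto
  then obtain p0' where p0': "path_in S' y' (h 1 r0) p0'"
    unfolding path_connected_path_in by blast
  have SC: "S \<subseteq> C" "S' \<subseteq> C"
    using S S' unfolding admissible_def by auto
  \<comment> \<open>The error is 4 * D for each of the two admissible sets and D for each of two
    joins.\<close>
  have "\<bar>val p + val (\<lambda>t. h t r) - val p'\<bar> \<le> \<bar>val p0 + val (\<lambda>t. h t r0) - val p0'\<bar> + 10 * D"
    if r: "r \<in> R" and p: "path_in S y r p" and p': "path_in S' y' (h 1 r) p'" for r p p'
  proof -
    obtain q where q: "path_in R r0 r q"
      using R(1) r r0 unfolding path_connected_path_in by blast
    have q0: "homotopic_paths C (h 0 \<circ> q) q"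
    proof (rule homotopic_paths_sym, rule path_in_homotopic_eq)
      show "path_in C r0 r q" using path_in_mono[OF q] R SC by blast
      show "q t = (h 0 \<circ> q) t" if "t \<in> {0..1}" for t
        using that q h0 unfolding path_in_def path_image_def by (auto simp: image_subset_iff)
    qed
    have q1: "path_in S' (h 1 r0) (h 1 r) (h 1 \<circ> q)"
      using path_in_image[OF q, of "h 1" S'] continuous_on_Times_section(2)[OF h(1), of 1] h1
      by (auto simp: image_subset_iff)
    have tr: "path_in C r (h 1 r) (\<lambda>t. h t r)" "path_in C r0 (h 1 r0) (\<lambda>t. h t r0)"
      using track_path[OF h r] track_path[OF h r0] h0 r r0 by auto
    have qS: "path_in S r0 r q" using path_in_mono[OF q R(2)] .
    have qC: "path_in C r0 r q" "path_in C (h 1 r0) (h 1 r) (h 1 \<circ> q)"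
      using path_in_mono[OF qS SC(1)] path_in_mono[OF q1 SC(2)] by auto
    have "homotopic_paths C (q +++ (\<lambda>t. h t r)) ((h 0 \<circ> q) +++ (\<lambda>t. h t r))"
      by (rule homotopic_join[OF homotopic_paths_sym[OF q0] homotopic_refl[OF tr(1)] qC(1) tr(1)])
    also have "homotopic_paths C \<dots> ((\<lambda>t. h t r0) +++ (h 1 \<circ> q))"
      by (rule track_exchange[OF h q])
    finally have "val (q +++ (\<lambda>t. h t r)) = val ((\<lambda>t. h t r0) +++ (h 1 \<circ> q))"
      by (rule val_homotopic)
    then show ?thesis
      using val_join[OF qC(1) tr(1)] val_join[OF tr(2) qC(2)]
        admissible_val[OF S p p0 qS] admissible_val[OF S' p' p0' q1]
      by linarith
  qed
  then show ?thesis by blast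
qed auto

lemma flow_track: "flow C h \<Longrightarrow> x \<in> C \<Longrightarrow> path_in C x (h 1 x) (\<lambda>t. h t x)"
  using track_path[of C h C x] unfolding flow_def by auto

lemma flow_exchange:
  assumes h: "flow C h" and q: "path_in C a b q"
  shows "homotopic_paths C (q +++ (\<lambda>t. h t b)) ((\<lambda>t. h t a) +++ (h 1 \<circ> q))"
proof -
  have ab: "a \<in> C" "b \<in> C" using path_in_points[OF q] by auto
  have "homotopic_paths C q (h 0 \<circ> q)"
    using q h unfolding flow_def path_in_def path_image_def
    by (intro path_in_homotopic_eq[OF q]) (auto simp: image_subset_iff)
  then have "homotopic_paths C (q +++ (\<lambda>t. h t b)) ((h 0 \<circ> q) +++ (\<lambda>t. h t b))"
    by (rule homotopic_join[OF _ homotopic_refl[OF flow_track[OF h ab(2)]] q flow_track[OF h ab(2)]])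
  also have "homotopic_paths C \<dots> ((\<lambda>t. h t a) +++ (h 1 \<circ> q))"
    using h unfolding flow_def by (intro track_exchange[OF _ _ q]) auto
  finally show ?thesis .
qed

text \<open>A loop of homeomorphisms moves the base point along a central loop.\<close>

lemma val_flow_same_end:
  assumes h: "flow C h" and g: "flow C g" and hg: "\<And>x. x \<in> C \<Longrightarrow> h 1 x = g 1 x" and x: "x \<in> C"
  shows "\<bar>val (\<lambda>t. h t x) - val (\<lambda>t. g t x)\<bar> \<le> 2 * D"
proof -
  let ?h = "\<lambda>t. h t x" and ?g = "\<lambda>t. g t x"
  have hx: "path_in C x (h 1 x) ?h" using flow_track[OF h x] .
  have gx: "path_in C x (h 1 x) ?g" using flow_track[OF g x] hg[OF x] by simp
  note gx' = path_in_reverse[OF gx]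
  \<comment> \<open>The exchange with h carries q past \<open>?h\<close> to
    \<open>h 1 \<circ> q\<close>, which agrees with \<open>g 1 \<circ> q\<close>; the exchange with
    g brings it back to q.\<close>
  have "homotopic_paths C (q +++ (?h +++ reversepath ?g)) ((?h +++ reversepath ?g) +++ q)"
    if q: "path_in C x x q" for q
  proof -
    have hq: "path_in C (h 1 x) (h 1 x) (h 1 \<circ> q)"
      using h continuous_on_Times_section(2)[of "{0..1}" C h 1] unfolding flow_def
      by (intro path_in_image[OF q]) auto
    have "homotopic_paths C (h 1 \<circ> q) (g 1 \<circ> q)"
      using q hg unfolding path_in_def path_image_def
      by (intro path_in_homotopic_eq[OF hq]) (auto simp: image_subset_iff)
    then have "homotopic_paths C ((\<lambda>t. g t x) +++ (h 1 \<circ> q)) ((\<lambda>t. g t x) +++ (g 1 \<circ> q))"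
      by (rule homotopic_join[OF homotopic_refl[OF gx] _ gx hq])
    also have "homotopic_paths C \<dots> (q +++ ?g)"
      by (rule homotopic_paths_sym[OF flow_exchange[OF g q]])
    finally have ex: "homotopic_paths C (?g +++ (h 1 \<circ> q)) (q +++ ?g)" .
    have "homotopic_paths C ((h 1 \<circ> q) +++ reversepath ?g)
        ((reversepath ?g +++ (?g +++ (h 1 \<circ> q))) +++ reversepath ?g)"
      by (rule homotopic_join[OF homotopic_paths_sym[OF homotopic_cancel_right[OF gx hq]] homotopic_refl[OF gx'] hq gx'])
    also have "homotopic_paths C \<dots> ((reversepath ?g +++ (q +++ ?g)) +++ reversepath ?g)"
      by (rule homotopic_join[OF homotopic_join[OF homotopic_refl[OF gx'] ex gx' path_in_join[OF gx hq]] homotopic_refl[OF gx']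
            path_in_join[OF gx' path_in_join[OF gx hq]] gx'])
    also have "homotopic_paths C \<dots> (reversepath ?g +++ ((q +++ ?g) +++ reversepath ?g))"
      by (rule homotopic_paths_sym[OF homotopic_assoc[OF gx' path_in_join[OF q gx] gx']])
    also have "homotopic_paths C \<dots> (reversepath ?g +++ (q +++ (?g +++ reversepath ?g)))"
      by (rule homotopic_join[OF homotopic_refl[OF gx'] homotopic_paths_sym[OF homotopic_assoc[OF q gx gx']]
            gx' path_in_join[OF path_in_join[OF q gx] gx']])
    also have "homotopic_paths C \<dots> (reversepath ?g +++ (q +++ (\<lambda>_. x)))"
      by (rule homotopic_join[OF homotopic_refl[OF gx'] homotopic_join[OF homotopic_refl[OF q] homotopic_rinv[OF gx] q path_in_join[OF gx gx']]
            gx' path_in_join[OF q path_in_join[OF gx gx']]])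
    also have "homotopic_paths C \<dots> (reversepath ?g +++ q)"
      by (rule homotopic_join[OF homotopic_refl[OF gx'] homotopic_rid[OF q] gx' path_in_join[OF q path_in_const[OF x]]])
    finally have ex': "homotopic_paths C ((h 1 \<circ> q) +++ reversepath ?g) (reversepath ?g +++ q)" .
    have "homotopic_paths C (q +++ (?h +++ reversepath ?g)) ((q +++ ?h) +++ reversepath ?g)"
      by (rule homotopic_assoc[OF q hx gx'])
    also have "homotopic_paths C \<dots> ((?h +++ (h 1 \<circ> q)) +++ reversepath ?g)"
      by (rule homotopic_join[OF flow_exchange[OF h q] homotopic_refl[OF gx'] path_in_join[OF q hx] gx'])
    also have "homotopic_paths C \<dots> (?h +++ ((h 1 \<circ> q) +++ reversepath ?g))"
      by (rule homotopic_paths_sym[OF homotopic_assoc[OF hx hq gx']])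
    also have "homotopic_paths C \<dots> (?h +++ (reversepath ?g +++ q))"
      by (rule homotopic_join[OF homotopic_refl[OF hx] ex' hx path_in_join[OF hq gx']])
    also have "homotopic_paths C \<dots> ((?h +++ reversepath ?g) +++ q)"
      by (rule homotopic_assoc[OF hx gx' q])
    finally show ?thesis .
  qed
  then have "val (?h +++ reversepath ?g) = 0"
    by (rule val_central[OF path_in_join[OF hx gx']])
  then show ?thesis
    using val_join[OF hx gx'] val_reverse[OF gx] by linarith
qed

text \<open>Running both flows simultaneously gives a flow with the same end as k, at a cost of 2 *
  D. Its track is the diagonal of the square \<open>g t (h s x)\<close>, hence homotopic to the two
  tracks in succession; their join costs the last D.\<close>

lemma val_flow_compose:
  assumes h: "flow C h" and g: "flow C g" and k: "flow C k"
    and kgh: "\<And>x. x \<in> C \<Longrightarrow> k 1 x = g 1 (h 1 x)" and x: "x \<in> C"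
  shows "\<bar>val (\<lambda>t. k t x) - val (\<lambda>t. h t x) - val (\<lambda>t. g t (h 1 x))\<bar> \<le> 3 * D"
proof -
  let ?k = "\<lambda>t x. g t (h t x)"
  have hC: "\<And>t x. t \<in> {0..1} \<Longrightarrow> x \<in> C \<Longrightarrow> h t x \<in> C" and gC: "\<And>t x. t \<in> {0..1} \<Longrightarrow> x \<in> C \<Longrightarrow> g t x \<in> C"
    and cont: "continuous_on ({0..1} \<times> C) (\<lambda>(t, x). h t x)" "continuous_on ({0..1} \<times> C) (\<lambda>(t, x). g t x)"
    and id: "\<And>x. x \<in> C \<Longrightarrow> h 0 x = x" "\<And>x. x \<in> C \<Longrightarrow> g 0 x = x"
    using h g unfolding flow_def by auto
  have "continuous_on ({0..1} \<times> C) (\<lambda>y. g (fst y) (h (fst y) (snd y)))"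
    using cont(1) hC
    by (intro continuous_on_Times_compose[OF cont(2)]) (auto simp: case_prod_unfold intro!: continuous_intros)
  then have k': "flow C ?k"
    unfolding flow_def using hC gC id by (auto simp: case_prod_unfold)
  have hx: "path_in C x (h 1 x) (\<lambda>t. h t x)" using flow_track[OF h x] .
  have gx: "path_in C (h 1 x) (g 1 (h 1 x)) (\<lambda>t. g t (h 1 x))"
    using flow_track[OF g] hC x by auto
  have "continuous_on ({0..1} \<times> {0..1}) (\<lambda>y. g (snd y) (h (fst y) x))"
  proof (rule continuous_on_Times_compose[OF cont(2)])
    show "continuous_on ({0..1} \<times> {0..1::real}) (\<lambda>y. h (fst y) x)"
      using x by (intro continuous_on_Times_compose[OF cont(1)]) (auto intro!: continuous_intros)
  qed (use hC x in \<open>auto intro!: continuous_intros\<close>)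
  then have "homotopic_paths C (\<lambda>s. g s (h s x)) ((\<lambda>s. g 0 (h s x)) +++ (\<lambda>t. g t (h 1 x)))"
    using homotopic_paths_diagonal[of "\<lambda>s t. g t (h s x)" C] hC gC x by (auto simp: case_prod_unfold)
  also have "homotopic_paths C \<dots> ((\<lambda>s. h s x) +++ (\<lambda>t. g t (h 1 x)))"
  proof (rule homotopic_join[OF homotopic_paths_sym homotopic_refl[OF gx]])
    show hom: "homotopic_paths C (\<lambda>s. h s x) (\<lambda>s. g 0 (h s x))"
      using hC id x by (intro path_in_homotopic_eq[OF hx]) auto
    show "path_in C x (h 1 x) (\<lambda>s. g 0 (h s x))"
      by (rule path_in_homotopic[OF hom hx])
  qed (rule gx)
  finally have "val (\<lambda>s. g s (h s x)) = val ((\<lambda>s. h s x) +++ (\<lambda>t. g t (h 1 x)))"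
    by (rule val_homotopic)
  then show ?thesis
    using val_join[OF hx gx] val_flow_same_end[OF k k' kgh x] by linarith
qed

end

section \<open>Products of small sets in the configuration space\<close>

text \<open>The sets \<open>B i\<close> may coincide: for neighbourhoods of a tuple with repeated
  entries, the box consists of the configurations close to a missing diagonal.\<close>

definition conf_box :: "('p::finite \<Rightarrow> 'a set) \<Rightarrow> ('p \<Rightarrow> 'a) set" where
  "conf_box B = {x. inj x \<and> (\<forall>i. x i \<in> B i)}"

lemma config_eq_conf_box: "config D = conf_box (\<lambda>_. D)"
  unfolding config_def conf_box_def by auto

lemma conf_box_mono: "(\<And>i. A i \<subseteq> B i) \<Longrightarrow> conf_box A \<subseteq> conf_box B"
  unfolding conf_box_def by blast

lemma conf_box_subset_config: "conf_box B \<subseteq> config UNIV"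
  unfolding conf_box_def config_def by auto

text \<open>F is the set of positions of the other strands, around which one point still has to
  move. Dimension at least two is felt here: an interval is not robust.\<close>

definition robust :: "'a::topological_space set \<Rightarrow> bool" where
  "robust W \<longleftrightarrow> infinite W \<and> (\<forall>F. finite F \<longrightarrow> path_connected (W - F))"

lemma ex_conf_box_avoiding:
  fixes B :: "'p::finite \<Rightarrow> 'a set"
  assumes "\<And>i. infinite (B i)" "finite F"
  shows "\<exists>y\<in>conf_box B. range y \<inter> F = {}"
proof -
  have "\<exists>y. inj_on y J \<and> (\<forall>i\<in>J. y i \<in> B i - F)" for J :: "'p set"
    using finite[of J]
  proof (induction J rule: finite_induct)
    case (insert j J)
    then obtain y where y: "inj_on y J" "\<forall>i\<in>J. y i \<in> B i - F" by blast
    have "infinite (B j - (F \<union> y ` J))"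
      using assms insert by (intro Diff_infinite_finite) auto
    then obtain v where "v \<in> B j - (F \<union> y ` J)"
      using infinite_imp_nonempty by blast
    with y insert show ?case
      by (intro exI[of _ "y(j := v)"]) (auto simp: inj_on_def)
  qed auto
  from this[of UNIV] obtain y where "inj y" "\<forall>i. y i \<in> B i - F" by auto
  then show ?thesis unfolding conf_box_def by auto
qed

text \<open>Strand j moves in \<open>B j\<close> minus the positions of the other strands, which is
  path connected by robustness.\<close>

lemma conf_box_move:
  assumes x: "x \<in> conf_box B" and W: "robust (B j)" and v: "v \<in> B j" "v \<notin> x ` (- {j})"
  shows "\<exists>p. path_in (conf_box B) x (x(j := v)) p"
proof -
  have "path_connected (B j - x ` (- {j}))"
    using W unfolding robust_def by auto
  moreover have "x j \<in> B j - x ` (- {j})"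
    using x unfolding conf_box_def by (auto dest: injD)
  ultimately obtain g where g: "path_in (B j - x ` (- {j})) (x j) v g"
    using v unfolding path_connected_path_in by blast
  have gB: "g t \<in> B j - x ` (- {j})" if "t \<in> {0..1}" for t
    using g that unfolding path_in_def path_image_def by blast
  have "path_in (conf_box B) x (x(j := v)) (\<lambda>t. x(j := g t))"
    unfolding path_in_def
  proof (intro conjI)
    have "continuous_on {0..1} (\<lambda>t. (x(j := g t)) i)" for i
      using g unfolding path_in_def path_def by (cases "i = j") auto
    then show "path (\<lambda>t. x(j := g t))"
      unfolding path_def by (rule continuous_on_coordinatewise_then_product)
    have "x(j := g t) \<in> conf_box B" if "t \<in> {0..1}" for t
      using gB[OF that] x unfolding conf_box_def inj_def by (simp add: image_iff) (metis ComplI singletonD)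
    then show "path_image (\<lambda>t. x(j := g t)) \<subseteq> conf_box B"
      unfolding path_image_def by auto
    show "pathstart (\<lambda>t. x(j := g t)) = x" "pathfinish (\<lambda>t. x(j := g t)) = x(j := v)"
      using g unfolding path_in_def pathstart_def pathfinish_def by auto
  qed
  then show ?thesis by blast
qed

text \<open>The points are moved one at a time; disjoint ranges keep every tuple mixed from x and y
  injective.\<close>

lemma conf_box_path_disjoint:
  fixes x y :: "'p::finite \<Rightarrow> 'a::topological_space"
  assumes x: "x \<in> conf_box B" and y: "y \<in> conf_box B" and W: "\<And>i. robust (B i)"
    and xy: "range x \<inter> range y = {}"
  shows "\<exists>p. path_in (conf_box B) x y p"
proof -
  let ?m = "\<lambda>J i. if i \<in> J then y i else x i"
  have mix: "?m J \<in> conf_box B" for J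
    using x y xy unfolding conf_box_def inj_def by auto
  have "\<exists>p. path_in (conf_box B) x (?m J) p" for J :: "'p set"
    using finite[of J]
  proof (induction J rule: finite_induct)
    case empty
    then show ?case using path_in_const[OF x] by auto
  next
    case (insert j J)
    then obtain p where p: "path_in (conf_box B) x (?m J) p" by blast
    have "y j \<notin> ?m J ` (- {j})"
      using insert y xy unfolding conf_box_def inj_def by auto
    then obtain q where q: "path_in (conf_box B) (?m J) ((?m J)(j := y j)) q"
      using conf_box_move[OF mix W, where j = j and v = "y j"] y unfolding conf_box_def by blast
    have "(?m J)(j := y j) = ?m (insert j J)"
      by auto
    then show ?case
      using path_in_join[OF p q] by auto
  qed
  from this[of UNIV] show ?thesis by simp
qed

text \<open>If the ranges of the two ends meet, moving points directly might make them collide. A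
  third configuration, disjoint from both, serves as an intermediate stop; it exists because the
  factors are infinite.\<close>

lemma path_connected_conf_box:
  fixes B :: "'p::finite \<Rightarrow> 'a::topological_space set"
  assumes W: "\<And>i. robust (B i)"
  shows "path_connected (conf_box B)"
  unfolding path_connected_path_in
proof (intro ballI)
  fix x x' assume x: "x \<in> conf_box B" and x': "x' \<in> conf_box B"
  have "\<exists>y\<in>conf_box B. range y \<inter> (range x \<union> range x') = {}"
    using W unfolding robust_def by (intro ex_conf_box_avoiding) auto
  then obtain y where y: "y \<in> conf_box B" "range x \<inter> range y = {}" "range x' \<inter> range y = {}"
    by blast
  obtain p p' where "path_in (conf_box B) x y p" "path_in (conf_box B) x' y p'"
    using conf_box_path_disjoint[OF x y(1) W y(2)] conf_box_path_disjoint[OF x' y(1) W y(3)] by blast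
  then show "\<exists>p. path_in (conf_box B) x x' p"
    using path_in_join path_in_reverse by blast
qed

section \<open>Compactness of the space of tuples, and the diagonal action on configurations\<close>

lemma compact_fun_UNIV:
  assumes "compact (UNIV :: 'a::topological_space set)"
  shows "compact (UNIV :: ('p \<Rightarrow> 'a) set)"
proof -
  have "compact_space (product_topology (\<lambda>_::'p. euclidean :: 'a topology) UNIV)"
    using assms by (subst compact_space_product_topology) (auto simp: compact_space_def)
  then show ?thesis
    unfolding euclidean_product_topology by (simp add: compact_space_def)
qed

text \<open>The centres run over all tuples, also those with repeated entries, as the configurations
  alone need not form a compact set.\<close>

lemma finite_tuple_cover:
  fixes V :: "('p::finite \<Rightarrow> 'a::topological_space) \<Rightarrow> 'p \<Rightarrow> 'a set"
  assumes "compact (UNIV :: 'a set)" "\<And>w i. open (V w i)" "\<And>w i. w i \<in> V w i"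
  shows "\<exists>J. finite J \<and> (\<forall>x. \<exists>w\<in>J. \<forall>i. x i \<in> V w i)"
proof -
  let ?U = "\<lambda>w. Pi\<^sub>E UNIV (V w)"
  obtain \<U> where "\<U> \<subseteq> range ?U" "finite \<U>" "UNIV \<subseteq> \<Union>\<U>"
  proof (rule compactE[OF compact_fun_UNIV[OF assms(1), where 'p = 'p]])
    show "UNIV \<subseteq> \<Union>(range ?U)"
      using assms(3) by (auto simp: PiE_iff)
    show "open B" if "B \<in> range ?U" for B
      using that assms(2) by (auto intro!: open_PiE)
  qed
  then obtain J where J: "finite J" "\<U> = ?U ` J"
    by (meson finite_subset_image)
  have "\<exists>w\<in>J. \<forall>i. x i \<in> V w i" for x
  proof -
    have "x \<in> \<Union>(?U ` J)" using \<open>UNIV \<subseteq> \<Union>\<U>\<close> J by auto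
    then show ?thesis by (auto simp: PiE_iff)
  qed
  with J(1) show ?thesis by blast
qed

lemma continuous_on_snd_coordinate: "continuous_on S (\<lambda>y. snd y i)"
  by (rule continuous_on_product_then_coordinatewise[OF continuous_on_snd[OF continuous_on_id]])

lemma flow_product:
  fixes h :: "real \<Rightarrow> 'a::topological_space \<Rightarrow> 'a"
  assumes h: "continuous_on ({0..1} \<times> UNIV) (\<lambda>(t, x). h t x)" and inj: "\<And>t. t \<in> {0..1} \<Longrightarrow> inj (h t)"
    and h0: "h 0 = id"
  shows "flow (config UNIV :: ('p::finite \<Rightarrow> 'a) set) (\<lambda>t x. h t \<circ> x)"
  unfolding flow_def
proof (intro conjI ballI)
  have "continuous_on ({0..1} \<times> config UNIV) (\<lambda>y. h (fst y) (snd y i))" for i :: 'p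
    by (rule continuous_on_Times_compose[OF h]) (auto intro!: continuous_intros continuous_on_snd_coordinate)
  then show "continuous_on ({0..1} \<times> config UNIV) (\<lambda>(t, x). h t \<circ> (x :: 'p \<Rightarrow> 'a))"
    unfolding case_prod_unfold comp_def by (intro continuous_on_coordinatewise_then_product)
qed (use inj h0 in \<open>auto simp: config_def inj_compose\<close>)

locale braid_quasimorphism = local_quasimorphism "config UNIV" "config \<Delta>" z \<phi> D
  for \<Delta> :: "'a::t2_space set" and z :: "'p::finite \<Rightarrow> 'a" and \<phi> D
begin

text \<open>\<open>X i\<close> may have infinitely many components, but it is covered by finitely
  many robust sets. One of them in each factor gives a path connected box on which a single
  reference point controls the defect; finitely many such choices occur, and the sum of their
  constants serves for all.\<close>

lemma conf_box_transition_bounded: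
  assumes B: "admissible (conf_box B) y" and B': "admissible (conf_box B') y'"
    and h: "flow (config UNIV :: ('p \<Rightarrow> 'a) set) (\<lambda>t x. h t \<circ> x)"
    and X: "\<And>i. \<exists>\<E>. finite \<E> \<and> (\<forall>W\<in>\<E>. robust W \<and> W \<subseteq> B i \<and> h 1 ` W \<subseteq> B' i) \<and> X i \<subseteq> \<Union>\<E>"
  shows "\<exists>K. \<forall>x\<in>conf_box X. \<forall>p p'. path_in (conf_box B) y x p \<longrightarrow> path_in (conf_box B') y' (h 1 \<circ> x) p' \<longrightarrow>
    \<bar>val p + val (\<lambda>t. h t \<circ> x) - val p'\<bar> \<le> K"
proof -
  obtain \<E> where \<E>: "\<And>i. finite (\<E> i)" "\<And>i W. W \<in> \<E> i \<Longrightarrow> robust W \<and> W \<subseteq> B i \<and> h 1 ` W \<subseteq> B' i"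
    "\<And>i. X i \<subseteq> \<Union>(\<E> i)"
    using X by metis
  let ?I = "Pi\<^sub>E UNIV \<E>"
  have fin: "finite ?I" using \<E>(1) by (intro finite_PiE) auto
  have "\<exists>K. \<forall>x\<in>conf_box e. \<forall>p p'. path_in (conf_box B) y x p \<longrightarrow> path_in (conf_box B') y' (h 1 \<circ> x) p' \<longrightarrow>
    \<bar>val p + val (\<lambda>t. h t \<circ> x) - val p'\<bar> \<le> K" if "e \<in> ?I" for e
  proof -
    have e: "robust (e i)" "e i \<subseteq> B i" "h 1 ` e i \<subseteq> B' i" for i
      using \<E>(2)[of "e i" i] that by auto
    have sub: "conf_box e \<subseteq> config UNIV"
      by (rule conf_box_subset_config)
    have h': "continuous_on ({0..1} \<times> config UNIV) (\<lambda>(t, x). h t \<circ> (x :: 'p \<Rightarrow> 'a))"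
      "\<And>t x. t \<in> {0..1} \<Longrightarrow> x \<in> config UNIV \<Longrightarrow> h t \<circ> (x :: 'p \<Rightarrow> 'a) \<in> config UNIV"
      "\<And>x. x \<in> config UNIV \<Longrightarrow> h 0 \<circ> (x :: 'p \<Rightarrow> 'a) = x"
      using h unfolding flow_def by auto
    show ?thesis
    proof (rule transition_bounded[OF B B' path_connected_conf_box[OF e(1)] conf_box_mono[OF e(2)]])
      show "continuous_on ({0..1} \<times> conf_box e) (\<lambda>(t, x). h t \<circ> (x :: 'p \<Rightarrow> 'a))"
        by (rule continuous_on_subset[OF h'(1)]) (use sub in auto)
      show "h t \<circ> x \<in> config UNIV" if "t \<in> {0..1}" "x \<in> conf_box e" for t x
        using h'(2) that sub by blast
      show "h 0 \<circ> x = x" if "x \<in> conf_box e" for x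
        using h'(3) that sub by blast
      show "h 1 \<circ> x \<in> conf_box B'" if "x \<in> conf_box e" for x
        using h'(2)[of 1 x] that sub e(3) unfolding conf_box_def config_def by fastforce
    qed
  qed
  then obtain K where K: "\<And>e x p p'. e \<in> ?I \<Longrightarrow> x \<in> conf_box e \<Longrightarrow> path_in (conf_box B) y x p \<Longrightarrow>
      path_in (conf_box B') y' (h 1 \<circ> x) p' \<Longrightarrow> \<bar>val p + val (\<lambda>t. h t \<circ> x) - val p'\<bar> \<le> K e"
    by metis
  have "\<bar>val p + val (\<lambda>t. h t \<circ> x) - val p'\<bar> \<le> (\<Sum>e\<in>?I. \<bar>K e\<bar>)"
    if x: "x \<in> conf_box X" and p: "path_in (conf_box B) y x p" "path_in (conf_box B') y' (h 1 \<circ> x) p'" for x p p'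
  proof -
    have "\<forall>i. \<exists>W\<in>\<E> i. x i \<in> W"
      using x \<E>(3) unfolding conf_box_def by blast
    then obtain e where "\<And>i. e i \<in> \<E> i" "\<And>i. x i \<in> e i"
      by metis
    then have e: "e \<in> ?I" "x \<in> conf_box e"
      using x unfolding conf_box_def by auto
    have "\<bar>K e\<bar> \<le> (\<Sum>e\<in>?I. \<bar>K e\<bar>)"
      using fin e by (intro member_le_sum) auto
    then show ?thesis
      using K[OF e p] by linarith
  qed
  then show ?thesis by blast
qed

text \<open>Contracting all strands at once conjugates a loop of the box, along the track of y, into
  a loop in T and thus in \<Delta>. Strands in a common set are moved by one injective map, and
  strands in different sets stay in disjoint ones, so no collision occurs.\<close>

lemma contraction_admissible:
  fixes W T :: "'p \<Rightarrow> 'a set" and H :: "'p \<Rightarrow> real \<Rightarrow> 'a \<Rightarrow> 'a"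
  assumes W: "\<And>i. robust (W i)" and T: "\<And>i. T i \<subseteq> W i \<inter> \<Delta>"
    and H: "\<And>i. continuous_on ({0..1} \<times> W i) (\<lambda>(t, x). H i t x)"
    and HW: "\<And>i t x. t \<in> {0..1} \<Longrightarrow> x \<in> W i \<Longrightarrow> H i t x \<in> W i"
    and HT: "\<And>i t x. t \<in> {0..1} \<Longrightarrow> x \<in> T i \<Longrightarrow> H i t x \<in> T i"
    and inj: "\<And>i t. t \<in> {0..1} \<Longrightarrow> inj_on (H i t) (W i)"
    and H0: "\<And>i x. x \<in> W i \<Longrightarrow> H i 0 x = x" and H1: "\<And>i x. x \<in> W i \<Longrightarrow> H i 1 x \<in> T i"
    and disj: "\<And>i j. W i \<inter> W j = {} \<or> W i = W j \<and> H i = H j"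
    and y: "y \<in> conf_box T"
  shows "admissible (conf_box W) y"
  unfolding admissible_def
proof (intro conjI allI impI conf_box_subset_config path_connected_conf_box W)
  show yW: "y \<in> conf_box W"
    using y T unfolding conf_box_def by blast
  fix q assume q: "path_in (conf_box W) y y q"
  define G where "G t x = (\<lambda>i. H i t (x i))" for t :: real and x :: "'p \<Rightarrow> 'a"
  have injG: "inj (G t x)" if "t \<in> {0..1}" "x \<in> conf_box W" for t x
  proof (rule injI)
    fix i j assume eq: "G t x i = G t x j"
    have x: "x i \<in> W i" "x j \<in> W j" "inj x" using that unfolding conf_box_def by auto
    have "G t x i \<in> W i \<inter> W j" using HW[OF that(1)] x eq unfolding G_def by (metis IntI)
    then have "W i = W j" "H i = H j" using disj[of i j] by auto
    then have "x i = x j"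
      using inj_onD[OF inj[OF that(1), of i]] eq x unfolding G_def by metis
    then show "i = j" using x(3) by (auto dest: injD)
  qed
  have GW: "G t x \<in> conf_box W" if "t \<in> {0..1}" "x \<in> conf_box W" for t x
    using injG[OF that] HW that unfolding conf_box_def by (auto simp: G_def)
  have GT: "G t x \<in> conf_box T" if "t \<in> {0..1}" "x \<in> conf_box T" for t x
  proof -
    have "x \<in> conf_box W" using that(2) T unfolding conf_box_def by blast
    from injG[OF that(1) this] show ?thesis
      using HT that unfolding conf_box_def by (auto simp: G_def)
  qed
  have G1: "G 1 x \<in> conf_box T" if "x \<in> conf_box W" for x
    using injG[OF _ that, of 1] H1 that unfolding conf_box_def by (auto simp: G_def)
  have G0: "G 0 x = x" if "x \<in> conf_box W" for x
    using H0 that unfolding conf_box_def by (auto simp: G_def)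
  have cont: "continuous_on ({0..1} \<times> conf_box W) (\<lambda>(t, x). G t x)"
    unfolding case_prod_unfold G_def
    by (rule continuous_on_coordinatewise_then_product, rule continuous_on_Times_compose[OF H])
      (auto intro!: continuous_intros continuous_on_snd_coordinate simp: conf_box_def)
  have sub: "conf_box W \<subseteq> config UNIV" "conf_box T \<subseteq> config \<Delta>"
    using conf_box_subset_config conf_box_mono[of T "\<lambda>_. \<Delta>"] T
    unfolding config_eq_conf_box[of \<Delta>] by auto
  \<comment> \<open>T is invariant, so the conjugating track lies in \<Delta> too. The whole
    conjugate is then local, and the value of q is exactly 0 rather than merely bounded.\<close>
  define \<eta> where "\<eta> = (\<lambda>t. G t y)"
  have \<eta>T: "path_in (conf_box T) y (G 1 y) \<eta>"
  proof -
    have "conf_box T \<subseteq> conf_box W" using T by (intro conf_box_mono) auto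
    then have "continuous_on ({0..1} \<times> conf_box T) (\<lambda>(t, x). G t x)"
      by (intro continuous_on_subset[OF cont]) auto
    from track_path[OF this GT y] show ?thesis
      unfolding G0[OF yW] \<eta>_def by simp
  qed
  have qT: "path_in (conf_box T) (G 1 y) (G 1 y) (G 1 \<circ> q)"
    using G1 continuous_on_Times_section(2)[OF cont, of 1] by (intro path_in_image[OF q]) auto
  have inC: "path_in (config UNIV) y (G 1 y) \<eta>" "path_in (config UNIV) (G 1 y) (G 1 y) (G 1 \<circ> q)"
    "path_in (config UNIV) y y q"
    using path_in_mono[OF \<eta>T order_trans[OF sub(2) L_subset]] path_in_mono[OF qT order_trans[OF sub(2) L_subset]]
      path_in_mono[OF q sub(1)] by auto
  note \<eta>' = path_in_reverse[OF inC(1)]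
  have q0: "homotopic_paths (config UNIV) q (G 0 \<circ> q)"
    using q G0 unfolding path_in_def path_image_def
    by (intro path_in_homotopic_eq[OF inC(3)]) (auto simp: image_subset_iff)
  have "homotopic_paths (config UNIV) q (q +++ (\<lambda>_. y))"
    by (rule homotopic_paths_sym[OF homotopic_rid[OF inC(3)]])
  also have "homotopic_paths (config UNIV) \<dots> (q +++ (\<eta> +++ reversepath \<eta>))"
    by (rule homotopic_join[OF homotopic_refl[OF inC(3)] homotopic_paths_sym[OF homotopic_rinv[OF inC(1)]]
          inC(3) path_in_const]) (use yW sub in auto)
  also have "homotopic_paths (config UNIV) \<dots> ((q +++ \<eta>) +++ reversepath \<eta>)"
    by (rule homotopic_assoc[OF inC(3,1) \<eta>'])
  also have "homotopic_paths (config UNIV) \<dots> (((G 0 \<circ> q) +++ \<eta>) +++ reversepath \<eta>)"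
    by (rule homotopic_join[OF homotopic_join[OF q0 homotopic_refl[OF inC(1)] inC(3,1)] homotopic_refl[OF \<eta>']
        path_in_join[OF inC(3,1)] \<eta>'])
  also have "homotopic_paths (config UNIV) \<dots> ((\<eta> +++ (G 1 \<circ> q)) +++ reversepath \<eta>)"
  proof (rule homotopic_join[OF _ homotopic_refl[OF \<eta>'] path_in_join[OF path_in_homotopic[OF q0 inC(3)] inC(1)] \<eta>'])
    show "homotopic_paths (config UNIV) ((G 0 \<circ> q) +++ \<eta>) (\<eta> +++ (G 1 \<circ> q))"
      unfolding \<eta>_def using GW sub by (intro track_exchange[OF cont _ q]) auto
  qed
  finally have "val q = val ((\<eta> +++ (G 1 \<circ> q)) +++ reversepath \<eta>)"
    by (rule val_homotopic)
  also have "\<dots> = 0"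
    by (rule val_local[OF path_in_mono[OF path_in_join[OF path_in_join[OF \<eta>T qT] path_in_reverse[OF \<eta>T]] sub(2)]])
  finally show "val q = 0" .
qed

end

section \<open>Coordinate half-balls\<close>

text \<open>A convex set not contained in a line stays path connected when countably many points are
  removed; injectivity keeps the preimage of F finite.\<close>

lemma robust_image:
  fixes E :: "'e::euclidean_space set" and g :: "'e \<Rightarrow> 'a::t1_space"
  assumes E: "convex E" "\<not> collinear E" and g: "continuous_on E g" "inj_on g E"
  shows "robust (g ` E)"
  unfolding robust_def
proof (intro conjI allI impI)
  have "infinite E"
  proof
    assume "finite E"
    then have "E = {} \<or> (\<exists>x. E = {x})"
      using convex_connected[OF E(1)] connected_finite_iff_sing by blast
    then show False using E(2) by auto
  qed
  then show "infinite (g ` E)" using finite_imageD[OF _ g(2)] by blast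
  fix F :: "'a set" assume F: "finite F"
  have "finite {x \<in> E. g x \<in> F}"
    using finite_vimage_IntI[OF F g(2)] by (simp add: vimage_def Int_def conj_commute)
  then have "path_connected (E - {x \<in> E. g x \<in> F})"
    by (intro path_connected_convex_diff_countable E uncountable_infinite countable_finite)
  moreover have "g ` E - F = g ` (E - {x \<in> E. g x \<in> F})" by auto
  ultimately show "path_connected (g ` E - F)"
    using path_connected_continuous_image continuous_on_subset[OF g(1)] by (metis Diff_subset)
qed

lemma not_collinear_interior:
  fixes E :: "'e::euclidean_space set"
  assumes "2 \<le> DIM('e)" "ball v r \<subseteq> E" "0 < r"
  shows "\<not> collinear E"
proof -
  have "ball v r \<subseteq> interior E" using assms(2) by (simp add: interior_maximal)
  then have "interior E \<noteq> {}" using assms(3) by auto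
  then have "aff_dim E = DIM('e)" by (rule aff_dim_nonempty_interior)
  then show ?thesis using assms(1) by (simp add: collinear_aff_dim)
qed

lemma convex_half_space: "convex half_space"
  by (auto simp: half_space_def convex_def)

lemma closed_half_space: "closed half_space"
  unfolding half_space_def by (intro closed_Collect_le continuous_intros)

lemma half_ball_contains_ball:
  fixes x :: "real^'d::finite"
  assumes x: "x \<in> half_space" and e: "0 < e"
  obtains v where "ball v (e / 2) \<subseteq> ball x e \<inter> half_space"
proof -
  let ?k = "SOME i::'d. True"
  \<comment> \<open>Moving the centre inward by e / 2 along the distinguished coordinate leaves room
    for a ball of radius e / 2 in the half-space and in the ball around x.\<close>
  let ?v = "x + (e / 2) *\<^sub>R axis ?k 1"
  have "y \<in> ball x e \<inter> half_space" if "y \<in> ball ?v (e / 2)" for y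
  proof -
    have n: "norm (y - ?v) < e / 2" using that by (simp add: dist_norm norm_minus_commute)
    have "norm (y - x) \<le> norm (y - ?v) + norm ((e / 2) *\<^sub>R axis ?k (1::real) :: real^'d)"
      using norm_triangle_ineq[of "y - ?v" "(e / 2) *\<^sub>R axis ?k 1"] by (simp add: algebra_simps)
    then have "norm (y - x) < e" using n e by simp
    have "\<bar>(y - ?v) $ ?k\<bar> < e / 2"
      using component_le_norm_cart[of "y - ?v" ?k] n by linarith
    then have "\<bar>y $ ?k - (x $ ?k + e / 2)\<bar> < e / 2" by simp
    moreover have "0 \<le> x $ ?k" using x unfolding half_space_def by simp
    ultimately have "0 \<le> y $ ?k" by linarith
    then show ?thesis using \<open>norm (y - x) < e\<close>
      unfolding half_space_def by (simp add: dist_norm norm_minus_commute)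
  qed
  then show ?thesis using that by (meson subsetI)
qed

text \<open>The shrinking runs through injective maps and ends inside T rather than at a point, so
  that it can be applied to several strands at once.\<close>

definition contracts :: "'a::topological_space set \<Rightarrow> 'a set \<Rightarrow> (real \<Rightarrow> 'a \<Rightarrow> 'a) \<Rightarrow> bool" where
  "contracts W T H \<longleftrightarrow> T \<subseteq> W \<and> continuous_on ({0..1} \<times> W) (\<lambda>(t, x). H t x) \<and>
     (\<forall>t\<in>{0..1}. H t ` W \<subseteq> W \<and> H t ` T \<subseteq> T \<and> inj_on (H t) W) \<and> (\<forall>x\<in>W. H 0 x = x \<and> H 1 x \<in> T)"

lemma contracts_homeomorphic_image:
  fixes E :: "'e::real_normed_vector set" and g :: "'e \<Rightarrow> 'a::topological_space"
  assumes hom: "homeomorphism E (g ` E) g c" and E: "convex E" "bounded E"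
    and v: "v \<in> E" and s: "0 < s"
  shows "\<exists>H. contracts (g ` E) (g ` (E \<inter> ball v s)) H"
proof -
  obtain b where b: "b > 0" "\<And>x. x \<in> E \<Longrightarrow> norm (x - v) < b"
  proof -
    obtain b where "\<forall>x\<in>E. dist v x \<le> b" using E(2) bounded_any_center[of E v] by auto
    then show ?thesis
      using that[of "\<bar>b\<bar> + 1"] by (force simp: dist_norm norm_minus_commute)
  qed
  \<comment> \<open>b exceeds the distance of every point of E from v, so scaling by this factor
    about v brings all of E within s of v.\<close>
  define \<kappa> where "\<kappa> = s / (s + b)"
  have \<kappa>: "0 < \<kappa>" "\<kappa> < 1" "\<kappa> * b < s"
    using s b(1) by (auto simp: \<kappa>_def field_simps)
  \<comment> \<open>The scaling factor at time t falls linearly from 1 to \<kappa>. It never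
    vanishes, which makes every stage injective, and convexity keeps the scaled points in E, also
    along the flat face of a half-ball.\<close>
  define l where "l t = 1 - t + t * \<kappa>" for t :: real
  have l: "0 < l t" "l t \<le> 1" if "t \<in> {0..1}" for t
  proof -
    have "l t = (1 - t) * 1 + t * \<kappa>" by (simp add: l_def)
    moreover have "\<kappa> \<le> 1 * (1 - t) + \<kappa> * t"
      using that \<kappa> mult_right_mono[of \<kappa> 1 "1 - t"] by (simp add: algebra_simps)
    ultimately show "0 < l t" using \<kappa> by (simp add: mult.commute)
    show "l t \<le> 1" unfolding l_def using that \<kappa> mult_left_mono[of \<kappa> 1 t] by auto
  qed
  define m where "m t x = v + l t *\<^sub>R (x - v)" for t x
  have mE: "m t x \<in> E" if "t \<in> {0..1}" "x \<in> E" for t x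
  proof -
    have "(1 - l t) *\<^sub>R v + l t *\<^sub>R x \<in> E"
      using E(1) v that l[OF that(1)] by (intro convexD_alt) auto
    then show ?thesis by (simp add: m_def algebra_simps)
  qed
  have mball: "m t x \<in> ball v s" if "t \<in> {0..1}" "x \<in> ball v s" for t x
  proof -
    have "l t * norm (x - v) \<le> norm (x - v)" using l[OF that(1)] by (simp add: mult_left_le_one_le)
    then show ?thesis using that l[OF that(1)] by (simp add: m_def dist_norm norm_minus_commute)
  qed
  have m1: "m 1 x \<in> ball v s" if "x \<in> E" for x
  proof -
    have "\<kappa> * norm (x - v) \<le> \<kappa> * b" using b(2)[OF that] \<kappa> by (intro mult_left_mono) auto
    then have "\<kappa> * norm (x - v) < s" using \<kappa>(3) by linarith
    then show ?thesis using \<kappa> by (simp add: m_def l_def dist_norm)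
  qed
  have m0: "m 0 x = x" for x by (simp add: m_def l_def)
  have mcont: "continuous_on ({0..1} \<times> E) (\<lambda>(t, x). m t x)"
    unfolding m_def l_def case_prod_unfold by (intro continuous_intros)
  have cg: "\<And>x. x \<in> E \<Longrightarrow> c (g x) = x" and gcont: "continuous_on E g" "continuous_on (g ` E) c"
    using hom unfolding homeomorphism_def by auto
  have "contracts (g ` E) (g ` (E \<inter> ball v s)) (\<lambda>t y. g (m t (c y)))"
    unfolding contracts_def
  proof (intro conjI ballI)
    have "continuous_on ({0..1} \<times> g ` E) (\<lambda>y. m (fst y) (c (snd y)))"
      by (rule continuous_on_Times_compose[OF mcont])
        (auto simp: cg intro!: continuous_intros continuous_on_compose2[OF gcont(2)])
    then show "continuous_on ({0..1} \<times> g ` E) (\<lambda>(t, y). g (m t (c y)))"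
      unfolding case_prod_unfold by (rule continuous_on_compose2[OF gcont(1)]) (auto simp: cg mE)
    fix t :: real assume t: "t \<in> {0..1}"
    show "inj_on (\<lambda>y. g (m t (c y))) (g ` E)"
    proof (rule inj_onI)
      fix y y' assume y: "y \<in> g ` E" "y' \<in> g ` E" and eq: "g (m t (c y)) = g (m t (c y'))"
      then obtain x x' where x: "x \<in> E" "x' \<in> E" "y = g x" "y' = g x'" by auto
      have "m t x = m t x'" using eq x cg mE[OF t] by metis
      then show "y = y'" using l(1)[OF t] x by (simp add: m_def)
    qed
  qed (use mE mball m0 m1 cg in auto)
  then show ?thesis by blast
qed

section \<open>Half-balls in charts, and openness and density of the cell\<close>

lemma smooth_atlas_chart:
  assumes "smooth_atlas A" obtains U c where "(U, c) \<in> A" "a \<in> U"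
proof -
  have "a \<in> (\<Union>(U, c)\<in>A. U)" using assms unfolding smooth_atlas_def by simp
  then show ?thesis using that by auto
qed

lemma chart_half_ball:
  fixes A :: "('a::topological_space, 'd::finite) chart set"
  assumes A: "smooth_atlas A" and N: "open N" "a \<in> N"
  obtains U c e where "(U, c) \<in> A" "a \<in> U" "0 < e" "ball (c a) e \<inter> half_space \<subseteq> c ` (N \<inter> U)"
proof -
  obtain U c where Uc: "(U, c) \<in> A" "a \<in> U"
    using smooth_atlas_chart[OF A] by metis
  then have U: "open U" "openin (top_of_set half_space) (c ` U)" "homeomorphism U (c ` U) c (inv_into U c)"
    using A unfolding smooth_atlas_def by auto
  have "openin (top_of_set U) (N \<inter> U)"
    using N by (metis inf_commute openin_open_Int)
  then have "openin (top_of_set (c ` U)) (c ` (N \<inter> U))"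
    using homeomorphism_imp_open_map[OF U(3)] by blast
  then have "openin (top_of_set half_space) (c ` (N \<inter> U))"
    using U(2) openin_trans by blast
  then have "\<exists>e>0. ball (c a) e \<inter> half_space \<subseteq> c ` (N \<inter> U)"
    using N Uc unfolding openin_contains_ball by blast
  then show ?thesis using that Uc by blast
qed

lemma chart_inverse_open:
  fixes A :: "('a::topological_space, 'd::finite) chart set"
  assumes A: "smooth_atlas A" and Uc: "(U, c) \<in> A" and E: "E \<subseteq> c ` U" "openin (top_of_set half_space) E"
  shows "open (inv_into U c ` E)"
proof -
  have U: "open U" "homeomorphism U (c ` U) c (inv_into U c)" "openin (top_of_set half_space) (c ` U)"
    using A Uc unfolding smooth_atlas_def by auto
  have "openin (top_of_set (c ` U)) E"
    by (rule openin_subset_trans[OF E(2,1) openin_imp_subset[OF U(3)]])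
  then have "openin (top_of_set U) (inv_into U c ` E)"
    using homeomorphism_imp_open_map[OF homeomorphism_symD[OF U(2)]] by blast
  then show ?thesis
    using U(1) openin_open_trans by blast
qed

lemma chart_homeomorphism_inverse:
  assumes "smooth_atlas A" "(U, c) \<in> A" "E \<subseteq> c ` U"
  shows "homeomorphism E (inv_into U c ` E) (inv_into U c) c"
proof -
  have "homeomorphism (c ` U) U (inv_into U c) c"
    using assms unfolding smooth_atlas_def by (auto intro: homeomorphism_symD)
  from homeomorphism_of_subsets[OF this assms(3)] show ?thesis
    using homeomorphism_image1[OF \<open>homeomorphism (c ` U) U (inv_into U c) c\<close>] assms(3) by blast
qed

text \<open>Invariance of domain: read in a chart, the ball parametrizes a piece of \<Delta>
  injectively between spaces of the same dimension, so the image is open in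
  \<open>real^'d\<close>.\<close>

lemma open_ball_image:
  fixes A :: "('a::topological_space, 'd::finite) chart set" and \<psi> :: "real^'d \<Rightarrow> 'a"
  assumes A: "smooth_atlas A" and hom: "homeomorphism (ball 0 1) \<Delta> \<psi> \<theta>"
  shows "open \<Delta>"
proof (subst open_subopen, intro ballI)
  fix a assume a: "a \<in> \<Delta>"
  obtain U c where Uc: "(U, c) \<in> A" "a \<in> U"
    using smooth_atlas_chart[OF A] by metis
  then have U: "open U" "openin (top_of_set half_space) (c ` U)" "homeomorphism U (c ` U) c (inv_into U c)"
    using A unfolding smooth_atlas_def by auto
  have \<psi>: "continuous_on (ball 0 1) \<psi>" "\<psi> ` ball 0 1 = \<Delta>" "\<And>x. x \<in> ball 0 1 \<Longrightarrow> \<theta> (\<psi> x) = x"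
    using hom unfolding homeomorphism_def by auto
  let ?N = "ball 0 1 \<inter> \<psi> -` U"
  have N: "open ?N"
    using continuous_open_preimage[OF \<psi>(1) open_ball U(1)] .
  have c: "continuous_on U c" "inj_on c U"
    using U(3) unfolding homeomorphism_def by (auto intro: inj_on_inverseI)
  have "open ((c \<circ> \<psi>) ` ?N)"
  proof (rule invariance_of_domain[OF _ N])
    show "continuous_on ?N (c \<circ> \<psi>)"
      by (intro continuous_on_compose continuous_on_subset[OF \<psi>(1)] continuous_on_subset[OF c(1)]) auto
    have "inj_on \<psi> ?N" by (rule inj_on_inverseI[of _ \<theta>]) (use \<psi> in auto)
    then show "inj_on (c \<circ> \<psi>) ?N"
      by (intro comp_inj_on inj_on_subset[OF c(2)]) auto
  qed
  moreover have sub: "(c \<circ> \<psi>) ` ?N \<subseteq> c ` U" by auto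
  moreover have "c ` U \<subseteq> half_space" using U(2) openin_imp_subset by blast
  ultimately have "open (inv_into U c ` ((c \<circ> \<psi>) ` ?N))"
    by (intro chart_inverse_open[OF A Uc(1)] open_subset) auto
  moreover have "inv_into U c ` ((c \<circ> \<psi>) ` ?N) = U \<inter> \<Delta>"
    using c(2) \<psi>(2) by (auto simp: image_comp image_iff inv_into_f_f)
  ultimately show "\<exists>T. open T \<and> a \<in> T \<and> T \<subseteq> \<Delta>"
    using a Uc by (metis IntI Int_lower2)
qed

text \<open>A volume form has positive density, so a nonempty open set has positive measure and must
  meet a set of full measure. The estimate is made on a full ball inside the half-space, where the
  density is at least half its value at the centre.\<close>

lemma volume_dense:
  fixes A :: "('a::t2_space, 'd::finite) chart set"
  assumes A: "smooth_atlas A" and mu: "volume_form A \<omega>" "volume_form_measure A \<omega> \<mu>" "prob_space \<mu>"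
    and \<Delta>: "emeasure \<mu> \<Delta> = 1" and N: "open N" "N \<noteq> {}"
  shows "N \<inter> \<Delta> \<noteq> {}"
proof
  assume disj: "N \<inter> \<Delta> = {}"
  obtain a where "a \<in> N" using N by auto
  then obtain U c e where Uc: "(U, c) \<in> A" "a \<in> U" "0 < e" and e: "ball (c a) e \<inter> half_space \<subseteq> c ` (N \<inter> U)"
    using chart_half_ball[OF A N(1)] by metis
  have "c a \<in> half_space"
    using A Uc openin_imp_subset unfolding smooth_atlas_def by fastforce
  then obtain v where v: "ball v (e / 2) \<subseteq> ball (c a) e \<inter> half_space"
    using half_ball_contains_ball Uc(3) by blast
  then have vU: "ball v (e / 2) \<subseteq> c ` (N \<inter> U)" using e by blast
  moreover have "v \<in> ball v (e / 2)" using Uc(3) by simp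
  ultimately have vin: "v \<in> c ` U" by blast
  have smooth: "smooth_on (c ` U) (\<omega> (U, c))" and pos: "0 < \<omega> (U, c) v"
    using mu(1) Uc(1) vin unfolding volume_form_def by auto
  have "\<exists>V g. open V \<and> v \<in> V \<and> (\<forall>k. Ck_on k V g) \<and> (\<forall>y\<in>V \<inter> c ` U. g y = \<omega> (U, c) y)"
    by (rule bspec[OF smooth[unfolded smooth_on_def] vin])
  then obtain V g where V: "open V" "v \<in> V" "\<forall>k. Ck_on k V g" "\<forall>y\<in>V \<inter> c ` U. g y = \<omega> (U, c) y"
    by (elim exE conjE)
  \<comment> \<open>\<open>smooth_on\<close> speaks of a local extension g; the case k = 0 of
    \<open>Ck_on\<close> is its continuity.\<close>
  have "continuous_on V g" using V(3)[rule_format, of 0] by simp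
  then have "open (V \<inter> g -` {\<omega> (U, c) v / 2 <..})"
    using continuous_open_preimage[OF _ V(1)] open_greaterThan by blast
  moreover have "v \<in> V \<inter> g -` {\<omega> (U, c) v / 2 <..}"
    using V(2) V(4)[rule_format, of v] vin pos by auto
  ultimately obtain r' where r': "0 < r'" "ball v r' \<subseteq> V \<inter> g -` {\<omega> (U, c) v / 2 <..}"
    using openE by blast
  define r where "r = min r' (e / 2)"
  have r: "0 < r" "ball v r \<subseteq> c ` (N \<inter> U)" "\<And>x. x \<in> ball v r \<Longrightarrow> \<omega> (U, c) v / 2 \<le> \<omega> (U, c) x"
  proof -
    show "0 < r" using r'(1) Uc(3) by (simp add: r_def)
    show sub: "ball v r \<subseteq> c ` (N \<inter> U)" using vU by (auto simp: r_def)
    fix x assume x: "x \<in> ball v r"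
    then have "x \<in> V" "\<omega> (U, c) v / 2 < g x" using r'(2) by (auto simp: r_def)
    then show "\<omega> (U, c) v / 2 \<le> \<omega> (U, c) x" using V(4)[rule_format, of x] x sub by auto
  qed
  have NU: "N \<inter> U \<in> sets borel" "sets \<mu> = sets borel"
    using N(1) A Uc(1) mu(2) unfolding smooth_atlas_def volume_form_measure_def by auto
  have "0 < ennreal (\<omega> (U, c) v / 2) * emeasure lborel (ball v r)"
    using pos r(1) by (simp add: ennreal_zero_less_mult_iff emeasure_lborel_ball_finite emeasure_ball unit_ball_vol_pos)
  also have "\<dots> = (\<integral>\<^sup>+x. ennreal (\<omega> (U, c) v / 2) * indicator (ball v r) x \<partial>lborel)"
    by (simp add: nn_integral_cmult_indicator)
  also have "\<dots> \<le> (\<integral>\<^sup>+x\<in>c ` (N \<inter> U). ennreal (\<omega> (U, c) x) \<partial>lborel)"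
    using r(2,3) by (intro nn_integral_mono) (auto simp: indicator_def intro!: ennreal_leI)
  also have "\<dots> = emeasure \<mu> (N \<inter> U)"
    using mu(2) Uc(1) NU(1) unfolding volume_form_measure_def by auto
  finally have pos: "0 < emeasure \<mu> (N \<inter> U)" .
  \<comment> \<open>A set outside \<open>sets \<mu>\<close> has \<open>emeasure\<close> 0, so the
    value 1 forces measurability.\<close>
  have "\<Delta> \<in> sets \<mu>"
    using \<Delta> emeasure_notin_sets by fastforce
  then have "emeasure \<mu> (N \<inter> U) + emeasure \<mu> \<Delta> = emeasure \<mu> ((N \<inter> U) \<union> \<Delta>)"
    using NU disj by (intro plus_emeasure) auto
  also have "\<dots> \<le> 1"
    using prob_space.emeasure_le_1[OF mu(3)] by blast
  finally have "1 + emeasure \<mu> (N \<inter> U) \<le> 1 + 0"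
    using \<Delta> by (simp add: add.commute)
  then have "emeasure \<mu> (N \<inter> U) \<le> 0"
    by (subst (asm) ennreal_add_left_cancel_le) auto
  with pos show False by simp
qed

text \<open>In coordinates, W is a half-ball around a, while T is a ball around some point b of W in
  \<Delta>, cut with the half-space; b exists by density and need not be close to a. V and K are the
  open and the closed half-ball of half the radius: V is meant for covering, K for compactness
  inside W.\<close>

lemma local_contraction:
  fixes A :: "('a::t2_space, 'd::finite) chart set" and \<Delta> N :: "'a set"
  assumes A: "smooth_atlas A" and dim: "2 \<le> CARD('d)"
    and \<Delta>: "open \<Delta>" "\<And>N. open N \<Longrightarrow> N \<noteq> {} \<Longrightarrow> N \<inter> \<Delta> \<noteq> {}" and N: "open N" "a \<in> N"
  shows "\<exists>W T H V K. open W \<and> W \<subseteq> N \<and> robust W \<and> contracts W T H \<and> T \<subseteq> \<Delta> \<and> infinite T \<and>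
    open V \<and> a \<in> V \<and> V \<subseteq> K \<and> compact K \<and> K \<subseteq> W"
proof -
  obtain U c e where Uc: "(U, c) \<in> A" "a \<in> U" "0 < e" and e: "ball (c a) e \<inter> half_space \<subseteq> c ` (N \<inter> U)"
    using chart_half_ball[OF A N] by metis
  have U: "open U" "openin (top_of_set half_space) (c ` U)" "homeomorphism U (c ` U) c (inv_into U c)"
    using A Uc unfolding smooth_atlas_def by auto
  then have half: "c ` U \<subseteq> half_space" using openin_imp_subset by blast
  let ?g = "inv_into U c"
  define E where "E = ball (c a) e \<inter> half_space"
  define W where "W = ?g ` E"
  have half_open: "openin (top_of_set half_space) (ball x r \<inter> half_space)" for x :: "real^'d" and r
    using openin_open_Int[OF open_ball[of x r], of half_space] by (simp only: Int_commute)
  have E: "E \<subseteq> c ` U" "convex E" "bounded E" "openin (top_of_set half_space) E"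
    using e by (auto simp: E_def convex_Int convex_half_space bounded_Int half_open)
  have hom: "homeomorphism E W ?g c"
    unfolding W_def by (rule chart_homeomorphism_inverse[OF A Uc(1) E(1)])
  have g: "continuous_on E ?g" "inj_on ?g E" "\<And>x. x \<in> E \<Longrightarrow> c (?g x) = x"
    using hom unfolding homeomorphism_def by (auto intro: inj_on_inverseI)
  have gc: "\<And>x. x \<in> U \<Longrightarrow> ?g (c x) = x"
    using U(3) unfolding homeomorphism_def by auto
  have half_E: "\<exists>v. ball v (r / 2) \<subseteq> ball x r \<inter> half_space" if "x \<in> half_space" "0 < r" for x :: "real^'d" and r
    using half_ball_contains_ball[OF that] by blast
  have robust_half: "robust (?g ` (ball x r \<inter> half_space))"
    if x: "x \<in> half_space" "0 < r" "ball x r \<inter> half_space \<subseteq> E" for x r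
  proof (rule robust_image)
    show "convex (ball x r \<inter> half_space)" by (simp add: convex_Int convex_half_space)
    obtain v where v: "ball v (r / 2) \<subseteq> ball x r \<inter> half_space" using half_E x by blast
    show "\<not> collinear (ball x r \<inter> half_space)"
      by (rule not_collinear_interior[OF _ v]) (use x dim in auto)
  qed (use that g in \<open>auto intro: continuous_on_subset inj_on_subset\<close>)
  have ca: "c a \<in> half_space" "c a \<in> E" using half Uc by (auto simp: E_def)
  have W: "open W" "W \<subseteq> N" "robust W"
  proof -
    show "open W" unfolding W_def by (rule chart_inverse_open[OF A Uc(1) E(1,4)])
    show "W \<subseteq> N" using e gc unfolding W_def E_def by force
    show "robust W" using robust_half[OF ca(1) Uc(3)] unfolding W_def E_def by simp
  qed
  have "W \<noteq> {}" using ca unfolding W_def by auto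
  then obtain b where b: "b \<in> W \<inter> \<Delta>" using \<Delta>(2)[OF W(1)] by auto
  have WU: "W \<subseteq> U" unfolding W_def using E(1) gc by force
  have "openin (top_of_set U) (W \<inter> \<Delta>)"
    using W(1) \<Delta>(1) WU by (intro open_subset) auto
  then have "openin (top_of_set half_space) (c ` (W \<inter> \<Delta>))"
    using homeomorphism_imp_open_map[OF U(3)] U(2) openin_trans by blast
  then obtain s where s: "0 < s" "ball (c b) s \<inter> half_space \<subseteq> c ` (W \<inter> \<Delta>)"
    using b unfolding openin_contains_ball by blast
  have cW: "c ` W = E" unfolding W_def using g(3) by force
  have bE: "c b \<in> E" using b cW by auto
  have eq: "E \<inter> ball (c b) s = ball (c b) s \<inter> half_space"
    using s(2) cW unfolding E_def by auto
  let ?T = "?g ` (E \<inter> ball (c b) s)"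
  obtain H where H: "contracts W ?T H"
    using contracts_homeomorphic_image[OF hom[unfolded W_def] E(2,3) bE s(1)] unfolding W_def by blast
  have T\<Delta>: "?T \<subseteq> \<Delta>" unfolding eq using s(2) gc WU by force
  have "robust ?T"
    unfolding eq by (rule robust_half) (use bE s cW in \<open>auto simp: E_def\<close>)
  then have T: "infinite ?T" unfolding robust_def by auto
  define V where "V = ?g ` (ball (c a) (e / 2) \<inter> half_space)"
  define K where "K = ?g ` (cball (c a) (e / 2) \<inter> half_space)"
  have sub: "cball (c a) (e / 2) \<inter> half_space \<subseteq> E" "ball (c a) (e / 2) \<inter> half_space \<subseteq> E"
    using Uc(3) by (auto simp: E_def)
  have "open V"
    unfolding V_def using sub(2) E(1)
    by (intro chart_inverse_open[OF A Uc(1)] half_open) auto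
  moreover have "a \<in> V" using gc Uc ca(1) unfolding V_def by (intro image_eqI[of _ _ "c a"]) auto
  moreover have "V \<subseteq> K" unfolding V_def K_def by (intro image_mono) auto
  moreover have "compact K"
    unfolding K_def using sub(1)
    by (intro compact_continuous_image continuous_on_subset[OF g(1)] compact_Int_closed compact_cball closed_half_space) auto
  moreover have "K \<subseteq> W" unfolding K_def W_def using sub(1) by (intro image_mono)
  ultimately show ?thesis using W H T\<Delta> T by blast
qed

section \<open>Bounded cohomological defect of isotopies\<close>

definition small_contraction ::
    "'a::topological_space set \<Rightarrow> 'a set \<Rightarrow> 'a \<Rightarrow> 'a set \<Rightarrow> 'a set \<Rightarrow> (real \<Rightarrow> 'a \<Rightarrow> 'a) \<Rightarrow> 'a set \<Rightarrow> 'a set \<Rightarrow> bool" where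
  "small_contraction \<Delta> N a W T H V K \<longleftrightarrow> open W \<and> W \<subseteq> N \<and> robust W \<and> contracts W T H \<and> T \<subseteq> \<Delta> \<and> infinite T \<and>
     open V \<and> a \<in> V \<and> V \<subseteq> K \<and> compact K \<and> K \<subseteq> W"

definition locally_contracts_into :: "'a::topological_space set \<Rightarrow> bool" where
  "locally_contracts_into \<Delta> \<longleftrightarrow>
     (\<forall>N a. open N \<longrightarrow> a \<in> N \<longrightarrow> (\<exists>W T H V K. small_contraction \<Delta> N a W T H V K))"

definition contractible_box ::
    "'a::topological_space set \<Rightarrow> ('p \<Rightarrow> 'a set) \<Rightarrow> ('p \<Rightarrow> 'a set) \<Rightarrow> ('p \<Rightarrow> real \<Rightarrow> 'a \<Rightarrow> 'a) \<Rightarrow> bool" where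
  "contractible_box \<Delta> W T H \<longleftrightarrow>
     (\<forall>i. open (W i) \<and> robust (W i) \<and> contracts (W i) (T i) (H i) \<and> T i \<subseteq> \<Delta> \<and> infinite (T i)) \<and>
     (\<forall>i j. W i \<inter> W j = {} \<or> W i = W j \<and> H i = H j)"

lemma finite_uniform_bound:
  fixes f :: "'x \<Rightarrow> real"
  assumes "finite I" "\<And>i. i \<in> I \<Longrightarrow> \<exists>K. \<forall>x. P i x \<longrightarrow> f x \<le> K"
  shows "\<exists>K. \<forall>i\<in>I. \<forall>x. P i x \<longrightarrow> f x \<le> K"
  using assms
proof (induction I rule: finite_induct)
  case (insert j I)
  then obtain K K' where "\<forall>i\<in>I. \<forall>x. P i x \<longrightarrow> f x \<le> K" "\<forall>x. P j x \<longrightarrow> f x \<le> K'"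
    by (metis insertCI)
  then show ?case by (intro exI[of _ "max K K'"]) (auto simp: le_max_iff_disj)
qed auto

lemma disjoint_open_neighbourhoods:
  fixes F :: "'a::t2_space set"
  assumes "finite F"
  shows "\<exists>N. (\<forall>a\<in>F. open (N a) \<and> a \<in> N a) \<and> (\<forall>a\<in>F. \<forall>b\<in>F. a \<noteq> b \<longrightarrow> N a \<inter> N b = {})"
proof -
  have "\<forall>a b. \<exists>P :: 'a set \<times> 'a set. a \<noteq> b \<longrightarrow> open (fst P) \<and> open (snd P) \<and> a \<in> fst P \<and> b \<in> snd P \<and> fst P \<inter> snd P = {}"
    using hausdorff by (metis fst_conv snd_conv)
  then obtain P :: "'a \<Rightarrow> 'a \<Rightarrow> 'a set \<times> 'a set" where P: "\<And>a b. a \<noteq> b \<Longrightarrow>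
      open (fst (P a b)) \<and> open (snd (P a b)) \<and> a \<in> fst (P a b) \<and> b \<in> snd (P a b) \<and> fst (P a b) \<inter> snd (P a b) = {}"
    by metis
  \<comment> \<open>Both orders occur because \<open>P a b\<close> and \<open>P b a\<close> are
    chosen independently; the intersection over b separates a from all other points of F at
    once.\<close>
  define N where "N a = (\<Inter>b\<in>F - {a}. fst (P a b) \<inter> snd (P b a))" for a
  have "a \<in> fst (P a b) \<inter> snd (P b a)" "open (fst (P a b) \<inter> snd (P b a))" if "b \<noteq> a" for a b
    using P[OF that] P[OF that[symmetric]] by (auto intro: open_Int)
  then have "open (N a)" "a \<in> N a" for a
    unfolding N_def using assms by (auto intro!: open_INT)
  moreover have "N a \<inter> N b = {}" if "a \<in> F" "b \<in> F" "a \<noteq> b" for a b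
  proof -
    have "N a \<subseteq> fst (P a b)" "N b \<subseteq> snd (P a b)" using that unfolding N_def by auto
    then show ?thesis using P[OF that(3)] by blast
  qed
  ultimately show ?thesis by blast
qed

definition box_neighbourhood where
  "box_neighbourhood \<Delta> w W T H V K \<longleftrightarrow> contractible_box \<Delta> W T H \<and>
     (\<forall>i. open (V i) \<and> w i \<in> V i \<and> V i \<subseteq> K i \<and> compact (K i) \<and> K i \<subseteq> W i)"

text \<open>The data are chosen for each point in the range of w, not for each index, so repeated
  entries automatically share W and H.\<close>

lemma ex_box_neighbourhood:
  fixes w :: "'p::finite \<Rightarrow> 'a::t2_space" and \<Delta> :: "'a set"
  assumes \<Delta>: "locally_contracts_into \<Delta>"
  shows "\<exists>W T H V K. box_neighbourhood \<Delta> w W T H V K"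
proof -
  have "finite (range w)" by simp
  from disjoint_open_neighbourhoods[OF this] obtain N where N:
    "\<forall>a\<in>range w. open (N a) \<and> a \<in> N a" "\<forall>a\<in>range w. \<forall>b\<in>range w. a \<noteq> b \<longrightarrow> N a \<inter> N b = {}"
    by (elim exE conjE)
  have "\<forall>a\<in>range w. \<exists>W T H V K. small_contraction \<Delta> (N a) a W T H V K"
    using \<Delta> N(1) unfolding locally_contracts_into_def by simp
  then obtain W T H V K where "\<And>a. a \<in> range w \<Longrightarrow> small_contraction \<Delta> (N a) a (W a) (T a) (H a) (V a) (K a)"
    by metis
  then have D: "small_contraction \<Delta> (N (w i)) (w i) (W (w i)) (T (w i)) (H (w i)) (V (w i)) (K (w i))" for i
    by simp
  have "W (w i) \<inter> W (w j) = {} \<or> W (w i) = W (w j) \<and> H (w i) = H (w j)" for i j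
  proof (cases "w i = w j")
    case False
    then have "N (w i) \<inter> N (w j) = {}" using N(2) by simp
    then show ?thesis using D[of i] D[of j] unfolding small_contraction_def by blast
  qed simp
  then have "box_neighbourhood \<Delta> w (\<lambda>i. W (w i)) (\<lambda>i. T (w i)) (\<lambda>i. H (w i)) (\<lambda>i. V (w i)) (\<lambda>i. K (w i))"
    unfolding box_neighbourhood_def contractible_box_def using D unfolding small_contraction_def by simp
  then show ?thesis by (intro exI)
qed

lemma ex_finite_contractible_cover:
  fixes \<Delta> :: "'a::t2_space set"
  assumes \<Delta>: "locally_contracts_into \<Delta>" and M: "compact (UNIV :: 'a set)"
  obtains J :: "('p::finite \<Rightarrow> 'a) set" and W T K :: "('p \<Rightarrow> 'a) \<Rightarrow> 'p \<Rightarrow> 'a set" and H where "finite J"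
    "\<And>w. w \<in> J \<Longrightarrow> contractible_box \<Delta> (W w) (T w) (H w)"
    "\<And>w i. w \<in> J \<Longrightarrow> compact (K w i)" "\<And>w i. w \<in> J \<Longrightarrow> K w i \<subseteq> W w i"
    "\<And>x. \<exists>w\<in>J. \<forall>i. x i \<in> K w i"
proof -
  obtain W T H V K where D: "\<And>w::'p \<Rightarrow> 'a. box_neighbourhood \<Delta> w (W w) (T w) (H w) (V w) (K w)"
    using ex_box_neighbourhood[OF \<Delta>] by metis
  obtain J where J: "finite J" "\<forall>x. \<exists>w\<in>J. \<forall>i. x i \<in> V w i"
    using finite_tuple_cover[OF M, of V] D unfolding box_neighbourhood_def by auto
  have "\<exists>w\<in>J. \<forall>i. x i \<in> K w i" for x
    using J(2)[rule_format, of x] D unfolding box_neighbourhood_def by (meson subsetD)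
  then show ?thesis
    using that[of J W T H K] J(1) D unfolding box_neighbourhood_def by blast
qed

lemma contractible_box_point:
  fixes W :: "'p::finite \<Rightarrow> 'a::topological_space set"
  assumes "contractible_box \<Delta> W T H"
  shows "\<exists>y. y \<in> conf_box T"
  using ex_conf_box_avoiding[of T "{}"] assms unfolding contractible_box_def by auto

lemma contractible_box_subset:
  fixes W :: "'p::finite \<Rightarrow> 'a::topological_space set"
  assumes "contractible_box \<Delta> W T H"
  shows "conf_box T \<subseteq> conf_box W" "conf_box T \<subseteq> config \<Delta>"
  using assms unfolding contractible_box_def contracts_def config_eq_conf_box
  by (auto intro!: conf_box_mono)

text \<open>Every configuration shares a path connected box with a configuration of \<Delta>, and
  the latter are connected among themselves.\<close>

lemma path_connected_config:
  fixes \<Delta> :: "'a::t2_space set"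
  assumes \<Delta>: "locally_contracts_into \<Delta>" and M: "compact (UNIV :: 'a set)"
    and L: "path_connected (config \<Delta> :: ('p::finite \<Rightarrow> 'a) set)"
  shows "path_connected (config UNIV :: ('p \<Rightarrow> 'a) set)"
proof -
  obtain J :: "('p \<Rightarrow> 'a) set" and W T K :: "('p \<Rightarrow> 'a) \<Rightarrow> 'p \<Rightarrow> 'a set" and H where
    D: "\<And>w. w \<in> J \<Longrightarrow> contractible_box \<Delta> (W w) (T w) (H w)" "\<And>w i. w \<in> J \<Longrightarrow> K w i \<subseteq> W w i"
      "\<And>x. \<exists>w\<in>J. \<forall>i. x i \<in> K w i"
    using ex_finite_contractible_cover[OF \<Delta> M] by metis
  have reach: "\<exists>y\<in>config \<Delta>. \<exists>p. path_in (config UNIV) y x p" if x: "x \<in> config UNIV" for x :: "'p \<Rightarrow> 'a"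
  proof -
    obtain w where w: "w \<in> J" "\<And>i. x i \<in> K w i" using D(3)[of x] by auto
    have box: "contractible_box \<Delta> (W w) (T w) (H w)" using D(1) w by blast
    obtain y where y: "y \<in> conf_box (T w)" using contractible_box_point[OF box] by blast
    have "y \<in> conf_box (W w)" "y \<in> config \<Delta>" using contractible_box_subset[OF box] y by auto
    moreover have "x \<in> conf_box (W w)"
      using x w(2) D(2)[OF w(1)] unfolding conf_box_def config_def by blast
    moreover have "path_connected (conf_box (W w))"
      using box unfolding contractible_box_def by (intro path_connected_conf_box) simp
    ultimately obtain p where "path_in (conf_box (W w)) y x p"
      unfolding path_connected_path_in by meson
    then have "path_in (config UNIV) y x p"
      by (rule path_in_mono[OF _ conf_box_subset_config])
    then show ?thesis using \<open>y \<in> config \<Delta>\<close> by blast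
  qed
  have sub: "config \<Delta> \<subseteq> (config UNIV :: ('p \<Rightarrow> 'a) set)" unfolding config_def by auto
  show ?thesis
    unfolding path_connected_path_in
  proof (intro ballI)
    fix x x' :: "'p \<Rightarrow> 'a" assume "x \<in> config UNIV" "x' \<in> config UNIV"
    then obtain y y' p p' where p: "y \<in> config \<Delta>" "y' \<in> config \<Delta>"
      "path_in (config UNIV) y x p" "path_in (config UNIV) y' x' p'"
      using reach by meson
    then obtain q where "path_in (config \<Delta>) y y' q"
      using L unfolding path_connected_path_in by meson
    then have "path_in (config UNIV) y y' q" by (rule path_in_mono[OF _ sub])
    then have "path_in (config UNIV) x x' (reversepath p +++ (q +++ p'))"
      using p by (intro path_in_join path_in_reverse)
    then show "\<exists>p. path_in (config UNIV) x x' p" by blast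
  qed
qed

text \<open>Supplies the covers needed for passing from one box to another under a
  homeomorphism.\<close>

lemma finite_robust_cover:
  fixes \<Delta> X N :: "'a::topological_space set"
  assumes \<Delta>: "locally_contracts_into \<Delta>" and X: "compact X" "X \<subseteq> N" "open N"
  shows "\<exists>\<E>. finite \<E> \<and> (\<forall>W\<in>\<E>. robust W \<and> W \<subseteq> N) \<and> X \<subseteq> \<Union>\<E>"
proof -
  let ?\<C> = "{W. open W \<and> robust W \<and> W \<subseteq> N}"
  have "\<exists>W\<in>?\<C>. a \<in> W" if "a \<in> X" for a
  proof -
    have "\<exists>W T H V K. small_contraction \<Delta> N a W T H V K"
      using \<Delta> that X unfolding locally_contracts_into_def by blast
    then show ?thesis unfolding small_contraction_def by blast
  qed
  then have "X \<subseteq> \<Union>?\<C>" by blast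
  then obtain \<E> where "\<E> \<subseteq> ?\<C>" "finite \<E>" "X \<subseteq> \<Union>\<E>"
    by (rule compactE[OF X(1)]) simp_all
  then show ?thesis by (intro exI[of _ \<E>]) auto
qed

text \<open>
  Although \<open>\<Delta> \<inter> K\<close> may have infinitely many components, compactness of the closed cell covers it by
  images of finitely many convex sets.
\<close>

lemma finite_cell_cover:
  fixes \<Phi> :: "'e::euclidean_space \<Rightarrow> 'a::t2_space"
  assumes dim: "2 \<le> DIM('e)" and \<Phi>: "continuous_on (cball 0 1) \<Phi>" "inj_on \<Phi> (ball 0 1)"
    and K: "compact K" "K \<subseteq> W" "open W"
  shows "\<exists>\<E>. finite \<E> \<and> (\<forall>E\<in>\<E>. robust E \<and> E \<subseteq> \<Phi> ` ball 0 1 \<and> E \<subseteq> W) \<and> \<Phi> ` ball 0 1 \<inter> K \<subseteq> \<Union>\<E>"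
proof -
  let ?Q = "cball 0 1 \<inter> \<Phi> -` K"
  have Q: "compact ?Q"
  proof -
    have "closed ?Q"
      using continuous_closed_preimage[OF \<Phi>(1) closed_cball compact_imp_closed[OF K(1)]] .
    then have "compact (cball 0 1 \<inter> ?Q)" by (rule compact_Int_closed[OF compact_cball])
    then show ?thesis by (simp add: Int_assoc[symmetric])
  qed
  have "\<exists>e>0. \<Phi> ` (ball v e \<inter> cball 0 1) \<subseteq> W" if v: "v \<in> ?Q" for v
  proof -
    have "openin (top_of_set (cball 0 1)) (cball 0 1 \<inter> \<Phi> -` W)"
      using continuous_openin_preimage_gen[OF \<Phi>(1) K(3)] .
    then obtain e where "0 < e" "ball v e \<inter> cball 0 1 \<subseteq> cball 0 1 \<inter> \<Phi> -` W"
      using v K(2) unfolding openin_contains_ball by blast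
    then show ?thesis by blast
  qed
  then obtain e where e: "\<And>v. v \<in> ?Q \<Longrightarrow> 0 < e v" "\<And>v. v \<in> ?Q \<Longrightarrow> \<Phi> ` (ball v (e v) \<inter> cball 0 1) \<subseteq> W"
    by metis
  obtain Q' where Q': "Q' \<subseteq> ?Q" "finite Q'" "?Q \<subseteq> (\<Union>v\<in>Q'. ball v (e v))"
  proof (rule compactE_image[OF Q, of ?Q "\<lambda>v. ball v (e v)"])
    show "?Q \<subseteq> (\<Union>v\<in>?Q. ball v (e v))"
    proof
      fix v assume v: "v \<in> ?Q"
      then have "v \<in> ball v (e v)" using e(1)[OF v] by simp
      with v show "v \<in> (\<Union>v\<in>?Q. ball v (e v))" by blast
    qed
  qed auto
  \<comment> \<open>The centre v may lie on the sphere. Intersecting with the open unit ball, where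
    \<Phi> is injective, still leaves an open convex set.\<close>
  define E where "E v = ball v (e v) \<inter> ball 0 1" for v
  have "robust (\<Phi> ` E v)" if "v \<in> Q'" "E v \<noteq> {}" for v
  proof (rule robust_image)
    show "convex (E v)" by (simp add: E_def convex_Int)
    have "open (E v)" by (simp add: E_def open_Int)
    with that obtain u r where r: "0 < r" "ball u r \<subseteq> E v"
      using openE by (metis all_not_in_conv)
    show "\<not> collinear (E v)" by (rule not_collinear_interior[OF dim r(2,1)])
    show "continuous_on (E v) \<Phi>" by (rule continuous_on_subset[OF \<Phi>(1)]) (auto simp: E_def)
    show "inj_on \<Phi> (E v)" by (rule inj_on_subset[OF \<Phi>(2)]) (auto simp: E_def)
  qed
  moreover have "\<Phi> ` E v \<subseteq> \<Phi> ` ball 0 1" "\<Phi> ` E v \<subseteq> W" if "v \<in> Q'" for v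
  proof -
    have "E v \<subseteq> ball v (e v) \<inter> cball 0 1" by (auto simp: E_def)
    then show "\<Phi> ` E v \<subseteq> W" using e(2)[of v] that Q'(1) by blast
    show "\<Phi> ` E v \<subseteq> \<Phi> ` ball 0 1" by (auto simp: E_def)
  qed
  moreover have "\<exists>v\<in>Q'. E v \<noteq> {} \<and> a \<in> \<Phi> ` E v" if a: "a \<in> \<Phi> ` ball 0 1 \<inter> K" for a
  proof -
    obtain u where u: "u \<in> ball 0 1" "a = \<Phi> u" using a by blast
    then have "u \<in> ?Q" using a by auto
    then obtain v where "v \<in> Q'" "u \<in> ball v (e v)" using Q'(3) by blast
    then show ?thesis using u unfolding E_def by blast
  qed
  then have "\<Phi> ` ball 0 1 \<inter> K \<subseteq> \<Union>((\<lambda>v. \<Phi> ` E v) ` {v \<in> Q'. E v \<noteq> {}})" by blast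
  ultimately show ?thesis
    using Q'(2) by (intro exI[of _ "(\<lambda>v. \<Phi> ` E v) ` {v \<in> Q'. E v \<noteq> {}}"]) simp
qed

section \<open>A primitive for the values of isotopies\<close>

lemma isotopy_flow:
  assumes "isotopy F f"
  shows "flow (config UNIV :: ('p::finite \<Rightarrow> 'a::topological_space) set) (\<lambda>t x. F t \<circ> x)"
proof (rule flow_product)
  show "inj (F t)" if t: "t \<in> {0..1}" for t
  proof -
    obtain g where "homeomorphism UNIV UNIV (F t) g" using assms t unfolding isotopy_def by blast
    then show ?thesis unfolding homeomorphism_def by (intro inj_on_inverseI) auto
  qed
qed (use assms in \<open>auto simp: isotopy_def\<close>)

context braid_quasimorphism
begin

lemma contractible_box_admissible:
  assumes "contractible_box \<Delta> W T H" "y \<in> conf_box T"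
  shows "admissible (conf_box W) y"
proof -
  have W: "\<And>i. robust (W i) \<and> contracts (W i) (T i) (H i) \<and> T i \<subseteq> \<Delta>"
    and disj: "\<And>i j. W i \<inter> W j = {} \<or> W i = W j \<and> H i = H j"
    using assms(1) unfolding contractible_box_def by auto
  show ?thesis
    by (rule contraction_admissible[where T = T and H = H, OF _ _ _ _ _ _ _ _ disj assms(2)])
      (use W in \<open>auto simp: contracts_def image_subset_iff\<close>)
qed

text \<open>\<open>b x\<close> is the value of a path to x inside the box selected for x. If x has
  box v and \<open>f \<circ> x\<close> has box v', the defect is that of the transition from v to
  v', and there are finitely many pairs. The bound on \<Delta> comes from the stationary isotopy,
  regarded as a transition from the admissible box of \<Delta> with base point z.\<close>

lemma isotopy_coboundary:
  fixes \<Phi> :: "'e::euclidean_space \<Rightarrow> 'a"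
  assumes \<Delta>: "locally_contracts_into \<Delta>" and M: "compact (UNIV :: 'a set)"
    and dim: "2 \<le> DIM('e)" and \<Phi>: "continuous_on (cball 0 1) \<Phi>" "inj_on \<Phi> (ball 0 1)" "\<Phi> ` ball 0 1 = \<Delta>"
  shows "\<exists>b. (\<exists>K. \<forall>x\<in>config \<Delta>. \<bar>b x\<bar> \<le> K) \<and>
    (\<forall>F f. isotopy F f \<longrightarrow> (\<exists>K. \<forall>x\<in>config UNIV. \<bar>val (\<lambda>t. F t \<circ> x) + b x - b (f \<circ> x)\<bar> \<le> K))"
proof -
  obtain J :: "('p \<Rightarrow> 'a) set" and W T K :: "('p \<Rightarrow> 'a) \<Rightarrow> 'p \<Rightarrow> 'a set" and H where J: "finite J"
    and box: "\<And>w. w \<in> J \<Longrightarrow> contractible_box \<Delta> (W w) (T w) (H w)"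
    and Kc: "\<And>w i. w \<in> J \<Longrightarrow> compact (K w i)" and KW: "\<And>w i. w \<in> J \<Longrightarrow> K w i \<subseteq> W w i"
    and cover: "\<And>x. \<exists>w\<in>J. \<forall>i. x i \<in> K w i"
    using ex_finite_contractible_cover[OF \<Delta> M] by metis
  have W: "open (W w i)" "robust (W w i)" if "w \<in> J" for w i
    using box[OF that] unfolding contractible_box_def by auto
  have "\<forall>w\<in>J. \<exists>y. y \<in> conf_box (T w)"
    using contractible_box_point box by blast
  then obtain y where y: "\<And>w. w \<in> J \<Longrightarrow> y w \<in> conf_box (T w)"
    by metis
  have adm: "admissible (conf_box (W w)) (y w)" if "w \<in> J" for w
    by (rule contractible_box_admissible[OF box[OF that] y[OF that]])
  have adm\<Delta>: "admissible (conf_box (\<lambda>_. \<Delta>)) z"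
    by (subst config_eq_conf_box[symmetric]) (rule admissible_L)
  \<comment> \<open>An arbitrary selection of a box for each tuple. b inherits no regularity from
    it, but only bounds are asked for.\<close>
  obtain w where w: "\<And>x. w x \<in> J" "\<And>x i. x i \<in> K (w x) i"
    using cover by metis
  define p where "p x = (SOME p. path_in (conf_box (W (w x))) (y (w x)) x p)" for x
  have wK: "x \<in> conf_box (K (w x))" if "x \<in> config UNIV" for x
    using w that unfolding conf_box_def config_def by auto
  have p: "path_in (conf_box (W (w x))) (y (w x)) x (p x)" if x: "x \<in> config UNIV" for x
  proof -
    have "x \<in> conf_box (W (w x))"
      using wK[OF x] KW[OF w(1)] unfolding conf_box_def by blast
    then have "\<exists>p. path_in (conf_box (W (w x))) (y (w x)) x p"
      using adm[OF w(1)[of x]] unfolding admissible_def path_connected_path_in by blast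
    then show ?thesis unfolding p_def by (rule someI_ex)
  qed
  define b where "b x = val (p x)" for x
  have "\<exists>C. \<forall>x\<in>config \<Delta>. \<bar>b x\<bar> \<le> C"
  proof -
    have "\<exists>C. \<forall>x. x \<in> conf_box (\<lambda>i. \<Delta> \<inter> K v i) \<and> w x = v \<longrightarrow> \<bar>b x\<bar> \<le> C" if v: "v \<in> J" for v
    proof -
      have "\<exists>\<E>. finite \<E> \<and> (\<forall>E\<in>\<E>. robust E \<and> E \<subseteq> \<Delta> \<and> id ` E \<subseteq> W v i) \<and> \<Delta> \<inter> K v i \<subseteq> \<Union>\<E>" for i
        using finite_cell_cover[OF dim \<Phi>(1,2), of "K v i" "W v i"] Kc[OF v] KW[OF v] W[OF v] unfolding \<Phi>(3) by auto
      moreover have "flow (config UNIV :: ('p \<Rightarrow> 'a) set) (\<lambda>t x. id \<circ> x)"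
        by (rule flow_product) (auto simp: case_prod_unfold intro!: continuous_intros)
      ultimately obtain C where C: "\<And>x q q'. x \<in> conf_box (\<lambda>i. \<Delta> \<inter> K v i) \<Longrightarrow> path_in (conf_box (\<lambda>_. \<Delta>)) z x q \<Longrightarrow>
          path_in (conf_box (W v)) (y v) (id \<circ> x) q' \<Longrightarrow> \<bar>val q + val (\<lambda>t. id \<circ> x) - val q'\<bar> \<le> C"
        using conf_box_transition_bounded[OF adm\<Delta> adm[OF v], of "\<lambda>_. id" "\<lambda>i. \<Delta> \<inter> K v i"]
        by metis
      have "\<bar>b x\<bar> \<le> C" if x: "x \<in> conf_box (\<lambda>i. \<Delta> \<inter> K v i)" "w x = v" for x
      proof -
        have xL: "x \<in> config \<Delta>" "x \<in> config UNIV" using x unfolding conf_box_def config_def by auto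
        \<comment> \<open>The path q in \<Delta> and the constant track have value 0, so the
          transition bound becomes a bound for \<open>b x\<close>.\<close>
        then obtain q where q: "path_in (config \<Delta>) z x q"
          using L_connected z_in unfolding path_connected_path_in by blast
        then show ?thesis
          using C[OF x(1), of q "p x"] p[OF xL(2)] x(2) val_local[OF q] val_const[OF xL(2)]
          unfolding config_eq_conf_box[of \<Delta>] b_def by (simp add: comp_def)
      qed
      then show ?thesis by blast
    qed
    then obtain C where C: "\<forall>v\<in>J. \<forall>x. x \<in> conf_box (\<lambda>i. \<Delta> \<inter> K v i) \<and> w x = v \<longrightarrow> \<bar>b x\<bar> \<le> C"
      using finite_uniform_bound[OF J, of "\<lambda>v x. x \<in> conf_box (\<lambda>i. \<Delta> \<inter> K v i) \<and> w x = v" "\<lambda>x. \<bar>b x\<bar>"] by blast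
    have "x \<in> conf_box (\<lambda>i. \<Delta> \<inter> K (w x) i)" if "x \<in> config \<Delta>" for x
      using that w(2) unfolding conf_box_def config_def by auto
    then show ?thesis using C w(1) by blast
  qed
  moreover have "\<exists>C. \<forall>x\<in>config UNIV. \<bar>val (\<lambda>t. F t \<circ> x) + b x - b (f \<circ> x)\<bar> \<le> C" if F: "isotopy F f" for F f
  proof -
    have F1: "F 1 = f" using F unfolding isotopy_def by simp
    obtain g where "homeomorphism UNIV UNIV f g"
      using F unfolding isotopy_def by force
    then have f: "continuous_on UNIV f" unfolding homeomorphism_def by simp
    note flow = isotopy_flow[OF F, where 'p = 'p]
    let ?P = "\<lambda>(v, v') x. x \<in> config UNIV \<and> w x = v \<and> w (f \<circ> x) = v'"
    let ?f = "\<lambda>x. \<bar>val (\<lambda>t. F t \<circ> x) + b x - b (f \<circ> x)\<bar>"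
    have fC: "f \<circ> x \<in> config UNIV" if "x \<in> config UNIV" for x :: "'p \<Rightarrow> 'a"
      using flow that F1 unfolding flow_def by fastforce
    have "\<exists>C. \<forall>x. ?P (v, v') x \<longrightarrow> ?f x \<le> C" if v: "v \<in> J" "v' \<in> J" for v v'
    proof -
      let ?X = "\<lambda>i. K v i \<inter> f -` K v' i"
      \<comment> \<open>The intersection is compact and lies in an open set, so a finite robust
        cover exists whatever f does to \<Delta>.\<close>
      have "\<exists>\<E>. finite \<E> \<and> (\<forall>E\<in>\<E>. robust E \<and> E \<subseteq> W v i \<and> F 1 ` E \<subseteq> W v' i) \<and> ?X i \<subseteq> \<Union>\<E>" for i
      proof -
        have "closed (f -` K v' i)"
          using Kc[OF v(2)] f by (intro closed_vimage compact_imp_closed) auto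
        then have "compact (?X i)" using Kc[OF v(1)] by (intro compact_Int_closed) auto
        moreover have "?X i \<subseteq> W v i \<inter> f -` W v' i" using KW v by blast
        moreover have "open (W v i \<inter> f -` W v' i)"
          using W(1) v f by (intro open_Int open_vimage) auto
        ultimately show ?thesis
          using finite_robust_cover[OF \<Delta>] unfolding F1 by (metis Int_subset_iff image_subset_iff_subset_vimage)
      qed
      from conf_box_transition_bounded[OF adm[OF v(1)] adm[OF v(2)] flow this] obtain C where C:
        "\<forall>x\<in>conf_box ?X. \<forall>q q'. path_in (conf_box (W v)) (y v) x q \<longrightarrow>
          path_in (conf_box (W v')) (y v') (F 1 \<circ> x) q' \<longrightarrow> \<bar>val q + val (\<lambda>t. F t \<circ> x) - val q'\<bar> \<le> C"
        by (elim exE)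
      have "?f x \<le> C" if x: "x \<in> config UNIV" "w x = v" "w (f \<circ> x) = v'" for x
      proof -
        have "x \<in> conf_box ?X"
          using x w(2)[of x] w(2)[of "f \<circ> x"] unfolding conf_box_def config_def by auto
        from C[rule_format, OF this, of "p x" "p (f \<circ> x)"] show ?thesis
          using p[OF x(1)] p[OF fC[OF x(1)]] x(2,3) unfolding F1 b_def by (simp add: algebra_simps)
      qed
      then show ?thesis by auto
    qed
    then obtain C where "\<forall>vv\<in>J \<times> J. \<forall>x. ?P vv x \<longrightarrow> ?f x \<le> C"
      using finite_uniform_bound[of "J \<times> J" ?P ?f] J by auto
    then show ?thesis using w(1) by (intro exI[of _ C]) auto
  qed
  ultimately show ?thesis by (intro exI[of _ b]) blast
qed

end

section \<open>Groups of homeomorphisms and word norms\<close>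

lemma isotopy_compose:
  assumes F: "isotopy F f" and G: "isotopy G g"
  shows "isotopy (\<lambda>t. F t \<circ> G t) (f \<circ> g)"
  unfolding isotopy_def
proof (intro conjI ballI)
  have cont: "continuous_on ({0..1} \<times> UNIV) (\<lambda>(t, x). F t x)" "continuous_on ({0..1} \<times> UNIV) (\<lambda>(t, x). G t x)"
    using F G unfolding isotopy_def by auto
  have "continuous_on ({0..1} \<times> UNIV) (\<lambda>y. F (fst y) (G (fst y) (snd y)))"
    using cont(2)
    by (intro continuous_on_Times_compose[OF cont(1)]) (auto simp: case_prod_unfold intro!: continuous_intros)
  then show "continuous_on ({0..1} \<times> UNIV) (\<lambda>(t, x). (F t \<circ> G t) x)"
    by (simp add: case_prod_unfold)
  show "\<exists>h. homeomorphism UNIV UNIV (F t \<circ> G t) h" if "t \<in> {0..1}" for t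
    using F G that homeomorphism_compose unfolding isotopy_def by metis
qed (use F G in \<open>auto simp: isotopy_def\<close>)

text \<open>The isotopy is run backwards after g. This avoids the inverses of the intermediate
  stages, whose joint continuity would have to be shown.\<close>

lemma isotopy_inverse:
  assumes F: "isotopy F f" and g: "homeomorphism UNIV UNIV f g"
  shows "isotopy (\<lambda>t. F (1 - t) \<circ> g) g"
  unfolding isotopy_def
proof (intro conjI ballI)
  have cont: "continuous_on ({0..1} \<times> UNIV) (\<lambda>(t, x). F t x)" and g': "continuous_on UNIV g"
    using F g unfolding isotopy_def homeomorphism_def by auto
  have "continuous_on ({0..1} \<times> UNIV) (\<lambda>y. F (1 - fst y) (g (snd y)))"
    by (rule continuous_on_Times_compose[OF cont])
      (auto intro!: continuous_intros continuous_on_compose2[OF g'])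
  then show "continuous_on ({0..1} \<times> UNIV) (\<lambda>(t, x). (F (1 - t) \<circ> g) x)"
    by (simp add: case_prod_unfold)
  show "\<exists>h. homeomorphism UNIV UNIV (F (1 - t) \<circ> g) h" if t: "t \<in> {0..1}" for t
  proof -
    obtain k where "homeomorphism UNIV UNIV (F (1 - t)) k"
      using F t unfolding isotopy_def by force
    then show ?thesis
      using homeomorphism_compose[OF homeomorphism_symD[OF g]] by blast
  qed
  show "F (1 - 0) \<circ> g = id" "F (1 - 1) \<circ> g = g"
    using F g unfolding isotopy_def homeomorphism_def by auto
qed

lemma isotopy_id: "isotopy (\<lambda>_. id) id"
  unfolding isotopy_def
  by (auto simp: case_prod_unfold intro!: continuous_intros exI[of _ id] homeomorphism_ident[unfolded id_def[symmetric]])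

lemma group_Homeo0: "group (Homeo0 A)"
proof (rule groupI)
  show "\<one>\<^bsub>Homeo0 A\<^esub> \<in> carrier (Homeo0 A)"
    unfolding Homeo0_def
    using isotopy_id homeomorphism_ident[of UNIV] by (auto simp: id_def intro!: exI[of _ UNIV])
  fix f assume f: "f \<in> carrier (Homeo0 A)"
  then obtain f' W F where f': "homeomorphism UNIV UNIV f f'" "open W" "mboundary A \<subseteq> W" "\<forall>x\<in>W. f x = x" "isotopy F f"
    unfolding Homeo0_def by auto
  show "\<exists>g\<in>carrier (Homeo0 A). g \<otimes>\<^bsub>Homeo0 A\<^esub> f = \<one>\<^bsub>Homeo0 A\<^esub>"
  proof (rule bexI[of _ f'])
    have "\<forall>x\<in>W. f' x = x" using f'(1,4) unfolding homeomorphism_def by (metis UNIV_I)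
    then show "f' \<in> carrier (Homeo0 A)"
      unfolding Homeo0_def using f' homeomorphism_symD[OF f'(1)] isotopy_inverse[OF f'(5,1)] by auto
    show "f' \<otimes>\<^bsub>Homeo0 A\<^esub> f = \<one>\<^bsub>Homeo0 A\<^esub>"
      unfolding Homeo0_def using f'(1) unfolding homeomorphism_def by auto
  qed
  fix g assume g: "g \<in> carrier (Homeo0 A)"
  then obtain g' W' G where g': "homeomorphism UNIV UNIV g g'" "open W'" "mboundary A \<subseteq> W'" "\<forall>x\<in>W'. g x = x" "isotopy G g"
    unfolding Homeo0_def by auto
  have "homeomorphism UNIV UNIV (f \<circ> g) (g' \<circ> f')"
    using homeomorphism_compose[OF g'(1) f'(1)] .
  moreover have "open (W \<inter> W')" "mboundary A \<subseteq> W \<inter> W'" "\<forall>x\<in>W \<inter> W'. (f \<circ> g) x = x"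
    using f' g' by auto
  ultimately show "f \<otimes>\<^bsub>Homeo0 A\<^esub> g \<in> carrier (Homeo0 A)"
    unfolding Homeo0_def using isotopy_compose[OF f'(5) g'(5)] by auto
qed (auto simp: Homeo0_def)

text \<open>Fekete's lemma: for n = q * m + r with r < m, the quotient at n exceeds that at m by at
  most a remainder of order 1 / n, so the limit is the infimum of the quotients.\<close>

lemma subadditive_convergent:
  fixes a :: "nat \<Rightarrow> nat"
  assumes sub: "\<And>m n. a (m + n) \<le> a m + a n"
  shows "\<exists>l\<ge>0. (\<lambda>n. real (a n) / real n) \<longlonglongrightarrow> l"
proof -
  \<comment> \<open>n = 0 is left out: division by 0 would give the quotient 0 and spoil the
    infimum.\<close>
  define X where "X = (\<lambda>n. real (a n) / real n) ` {1..}"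
  define l where "l = Inf X"
  have X: "X \<noteq> {}" "bdd_below X" "\<And>x. x \<in> X \<Longrightarrow> 0 \<le> x"
    unfolding X_def by (auto intro!: bdd_belowI[of _ 0])
  have mult: "a (q * m) \<le> q * a m" if "1 \<le> q" for q m
    using that
  proof (induction q rule: dec_induct)
    case (step q)
    then show ?case using sub[of m "q * m"] by simp
  qed simp
  have lower: "l \<le> real (a n) / real n" if "1 \<le> n" for n
    unfolding l_def using X(2) that by (intro cInf_lower) (auto simp: X_def)
  have "(\<lambda>n. real (a n) / real n) \<longlonglongrightarrow> l"
  proof (rule LIMSEQ_I)
    fix e :: real assume e: "0 < e"
    have "\<exists>x\<in>X. x < l + e / 2"
      using cInf_lessD[of X "l + e / 2"] X(1) e unfolding l_def by auto
    then obtain m where m: "1 \<le> m" "real (a m) / real m < l + e / 2"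
      unfolding X_def by auto
    define B where "B = Max (a ` {..<m}) + a m"
    have aB: "a r \<le> Max (a ` {..<m})" if "r < m" for r
      using that by (intro Max_ge) auto
    have up: "real (a n) / real n \<le> real (a m) / real m + real B / real n" if n: "1 \<le> n" for n
    proof -
      have "a n \<le> (n div m) * a m + B"
      proof (cases "n div m = 0")
        case True
        then have "n < m" using m by (simp add: div_eq_0_iff)
        then show ?thesis using aB[of n] unfolding B_def by (simp add: trans_le_add1)
      next
        case False
        have "a n \<le> a ((n div m) * m) + a (n mod m)"
          using sub[of "(n div m) * m" "n mod m"] by simp
        moreover have "a ((n div m) * m) \<le> (n div m) * a m" using False by (intro mult) simp
        moreover have "a (n mod m) \<le> Max (a ` {..<m})" using m by (intro aB) simp
        ultimately show ?thesis unfolding B_def by linarith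
      qed
      then have "real (a n) \<le> real (n div m) * real (a m) + real B"
        by (metis of_nat_add of_nat_le_iff of_nat_mult)
      also have "\<dots> \<le> (real n / real m) * real (a m) + real B"
        by (intro add_right_mono mult_right_mono) (auto simp: of_nat_div_le_of_nat)
      finally have "real (a n) / real n \<le> ((real n / real m) * real (a m) + real B) / real n"
        using n by (intro divide_right_mono) auto
      also have "\<dots> = real (a m) / real m + real B / real n"
        using n by (simp add: field_simps)
      finally show ?thesis .
    qed
    obtain N where N: "real B / (e / 2) < real N" using reals_Archimedean2 by blast
    have "norm (real (a n) / real n - l) < e" if n: "max 1 N \<le> n" for n
    proof -
      have "real B / (e / 2) < real n" using N n by linarith
      then have "real B / real n < e / 2" using n e by (simp add: field_simps)
      moreover have "1 \<le> n" using n by simp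
      ultimately show ?thesis
        using up[of n] lower[of n] m(2) unfolding real_norm_def by linarith
    qed
    then show "\<exists>no. \<forall>n\<ge>no. norm (real (a n) / real n - l) < e" by blast
  qed
  moreover have "0 \<le> l" unfolding l_def by (intro cInf_greatest X)
  ultimately show ?thesis by blast
qed

section \<open>Words, word norms and the growth criterion\<close>

definition word :: "('g, 'b) monoid_scheme \<Rightarrow> 'g set \<Rightarrow> 'g \<Rightarrow> 'g list \<Rightarrow> bool" where
  "word G S g ws \<longleftrightarrow> set ws \<subseteq> S \<union> m_inv G ` S \<and> foldr (\<otimes>\<^bsub>G\<^esub>) ws \<one>\<^bsub>G\<^esub> = g"

lemma word_norm_word: "word_norm G S g = (LEAST k. \<exists>ws. length ws = k \<and> word G S g ws)"
  unfolding word_norm_def word_def by simp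

lemma word_norm_le: "word G S g ws \<Longrightarrow> word_norm G S g \<le> length ws"
  unfolding word_norm_word by (rule Least_le) auto

context group
begin

lemma foldr_closed: "set ws \<subseteq> carrier G \<Longrightarrow> foldr (\<otimes>) ws \<one> \<in> carrier G"
  by (induction ws) auto

lemma foldr_append:
  "set us \<subseteq> carrier G \<Longrightarrow> set vs \<subseteq> carrier G \<Longrightarrow> foldr (\<otimes>) (us @ vs) \<one> = foldr (\<otimes>) us \<one> \<otimes> foldr (\<otimes>) vs \<one>"
  by (induction us) (auto simp: foldr_closed m_assoc)

lemma word_carrier: "generating_set G S \<Longrightarrow> word G S g ws \<Longrightarrow> set ws \<subseteq> carrier G"
  unfolding generating_set_def word_def by (meson Un_least image_subsetI inv_closed order_trans subsetD)

lemma word_append: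
  "generating_set G S \<Longrightarrow> word G S g us \<Longrightarrow> word G S h vs \<Longrightarrow> word G S (g \<otimes> h) (us @ vs)"
  using foldr_append[of us vs] word_carrier[of S g us] word_carrier[of S h vs] unfolding word_def by auto

lemma ex_word:
  assumes S: "generating_set G S" and g: "g \<in> carrier G"
  shows "\<exists>ws. word G S g ws"
proof -
  have "g \<in> generate G S" using S g unfolding generating_set_def by simp
  then show ?thesis
  proof (induction rule: generate.induct)
    case one
    then show ?case by (intro exI[of _ "[]"]) (simp add: word_def)
  next
    case (incl h)
    then have "h \<in> carrier G" using S unfolding generating_set_def by auto
    with incl show ?case by (intro exI[of _ "[h]"]) (simp add: word_def)
  next
    case (inv h)
    then have "h \<in> carrier G" using S unfolding generating_set_def by auto
    with inv show ?case by (intro exI[of _ "[inv h]"]) (simp add: word_def)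
  next
    case (eng h1 h2)
    then show ?case using word_append[OF S] by blast
  qed
qed

lemma ex_shortest_word:
  assumes "generating_set G S" "g \<in> carrier G"
  shows "\<exists>ws. word G S g ws \<and> length ws = word_norm G S g"
  using LeastI_ex[of "\<lambda>k. \<exists>ws. length ws = k \<and> word G S g ws"] ex_word[OF assms]
  unfolding word_norm_word[symmetric] by auto

lemma word_norm_mult:
  assumes S: "generating_set G S" and g: "g \<in> carrier G" "h \<in> carrier G"
  shows "word_norm G S (g \<otimes> h) \<le> word_norm G S g + word_norm G S h"
proof -
  obtain us vs where u: "word G S g us" "length us = word_norm G S g" "word G S h vs" "length vs = word_norm G S h"
    using ex_shortest_word[OF S g(1)] ex_shortest_word[OF S g(2)] by blast
  show ?thesis using word_norm_le[OF word_append[OF S u(1,3)]] u(2,4) by simp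
qed

text \<open>The translation length exists by subadditivity. If it were 0, the bound along shortest
  words would make \<open>\<bar>\<Psi> k\<bar> / real k\<close> tend to 0. The summand 1 allows for
  a constant error and disappears in the limit.\<close>

lemma undistorted_fg_if_growth:
  assumes g: "g \<in> carrier G"
    and \<Psi>: "\<And>S. finite S \<Longrightarrow> generating_set G S \<Longrightarrow>
      \<exists>C. \<forall>k ws. word G S (g [^] k) ws \<longrightarrow> \<bar>\<Psi> k\<bar> \<le> C * (real (length ws) + 1)"
    and growth: "limsup (\<lambda>k. ereal (\<bar>\<Psi> k\<bar> / real k)) > 0"
  shows "undistorted_fg G g"
  unfolding undistorted_fg_def
proof (intro allI impI)
  fix S assume S: "finite S \<and> generating_set G S"
  define a where "a k = word_norm G S (g [^] k)" for k :: nat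
  have "a (m + n) \<le> a m + a n" for m n
    unfolding a_def using word_norm_mult[of S "g [^] m" "g [^] n"] S g by (simp add: nat_pow_mult)
  then obtain l where l: "0 \<le> l" "(\<lambda>k. real (a k) / real k) \<longlonglongrightarrow> l"
    using subadditive_convergent by blast
  have "l \<noteq> 0"
  proof
    assume l0: "l = 0"
    obtain C where C: "\<And>k ws. word G S (g [^] k) ws \<Longrightarrow> \<bar>\<Psi> k\<bar> \<le> C * (real (length ws) + 1)"
      using \<Psi>[of S] S by blast
    \<comment> \<open>For k = 0 both sides are 0, since division by 0 yields 0.\<close>
    have "\<bar>\<Psi> k\<bar> / real k \<le> C * (real (a k) / real k) + C * (1 / real k)" for k
    proof -
      obtain ws where "word G S (g [^] k) ws" "length ws = a k"
        using ex_shortest_word[of S "g [^] k"] S g unfolding a_def by auto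
      then have "\<bar>\<Psi> k\<bar> \<le> C * (real (a k) + 1)" using C by fastforce
      then have "\<bar>\<Psi> k\<bar> / real k \<le> C * (real (a k) + 1) / real k" by (intro divide_right_mono) auto
      then show ?thesis by (simp add: algebra_simps add_divide_distrib)
    qed
    then have "limsup (\<lambda>k. ereal (\<bar>\<Psi> k\<bar> / real k)) \<le> limsup (\<lambda>k. ereal (C * (real (a k) / real k) + C * (1 / real k)))"
      by (intro Limsup_mono always_eventually) simp
    also have "\<dots> = ereal (C * 0 + C * 0)"
    proof (rule lim_imp_Limsup)
      show "(\<lambda>k. ereal (C * (real (a k) / real k) + C * (1 / real k))) \<longlonglongrightarrow> ereal (C * 0 + C * 0)"
        unfolding lim_ereal using l(2) lim_1_over_n l0 by (intro tendsto_intros) auto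
    qed simp
    finally show False using growth by (simp add: zero_ereal_def)
  qed
  then show "\<exists>l>0. (\<lambda>k. real (word_norm G S (g [^] k)) / real k) \<longlonglongrightarrow> l"
    using l unfolding a_def by (intro exI[of _ l]) auto
qed

end

text \<open>A function that is not integrable has integral 0 by convention, so a pointwise bound
  carries over even when measurability is unknown.\<close>

lemma (in prob_space) abs_integral_le_bound:
  fixes g :: "'a \<Rightarrow> real"
  assumes "\<And>x. \<bar>g x\<bar> \<le> B"
  shows "\<bar>\<integral>x. g x \<partial>M\<bar> \<le> B"
proof (cases "integrable M g")
  case True
  have "g x \<le> B" "- B \<le> g x" for x using assms[of x] by (auto simp: abs_le_iff)
  then have "(\<integral>x. g x \<partial>M) \<le> B" "- B \<le> (\<integral>x. g x \<partial>M)"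
    using integral_le_const[OF True] integral_ge_const[OF True] by auto
  then show ?thesis by linarith
next
  case False
  have "0 \<le> B" using assms[of undefined] by linarith
  with False show ?thesis by (simp add: not_integrable_integral_eq)
qed

lemma Psi_integral_bound:
  fixes z :: "'p::finite \<Rightarrow> 'a::topological_space"
  assumes "prob_space \<mu>" "0 \<le> B" "\<And>x. x \<in> gamma_domain \<Delta> \<psi> z (F 1) \<Longrightarrow> \<bar>\<phi> (gamma \<psi> z F x)\<bar> \<le> B"
  shows "\<bar>Psi_integral \<mu> \<Delta> \<psi> z \<phi> F\<bar> \<le> B"
proof -
  interpret prob_space "Pi\<^sub>M UNIV (\<lambda>_::'p. \<mu>)"
    by (intro prob_space_PiM assms)
  show ?thesis
    unfolding Psi_integral_def set_lebesgue_integral_def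
    using assms(2,3) by (intro abs_integral_le_bound) (auto simp: indicator_def)
qed

section \<open>The braids of a product of homeomorphisms\<close>

text \<open>One formula for motion and rest, which makes continuity visible; for u = v the quotient
  is 0 and the point rests.\<close>

lemma geodesic_min:
  "0 \<le> s \<Longrightarrow> geodesic u v s = u + (min s (dist u v) / dist u v) *\<^sub>R (v - u)"
  unfolding geodesic_def by (auto simp: min_def)

lemma geodesic_endpoints: "geodesic u v 0 = u" "dist u v \<le> s \<Longrightarrow> geodesic u v s = v"
  by (auto simp: geodesic_def)

lemma geodesic_in_convex:
  assumes "convex B" "u \<in> B" "v \<in> B" "0 \<le> s"
  shows "geodesic u v s \<in> B"
proof -
  define r where "r = min s (dist u v) / dist u v"
  have "0 \<le> r" "r \<le> 1"
    using assms(4) unfolding r_def by (auto simp: divide_le_eq_1 zero_less_dist_iff)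
  then have "(1 - r) *\<^sub>R u + r *\<^sub>R v \<in> B" using assms by (intro convexD_alt) auto
  moreover have "(1 - r) *\<^sub>R u + r *\<^sub>R v = geodesic u v s"
    unfolding geodesic_min[OF assms(4)] r_def[symmetric] by (simp add: algebra_simps)
  ultimately show ?thesis by simp
qed

lemma continuous_on_geodesic: "continuous_on {0..} (geodesic u v)"
proof -
  have "continuous_on {0..} (\<lambda>s. u + (min s (dist u v) / dist u v) *\<^sub>R (v - u))"
    unfolding divide_inverse by (intro continuous_intros)
  then show ?thesis by (rule continuous_on_eq) (simp add: geodesic_min)
qed

text \<open>Convexity of the ball keeps the points in \<Delta>, and \<open>ell_defined\<close> keeps
  them distinct. The connecting paths are therefore local.\<close>

lemma ell_path:
  fixes \<psi> :: "real^'d::finite \<Rightarrow> 'a::topological_space" and x y :: "'p::finite \<Rightarrow> 'a"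
  assumes hom: "homeomorphism (ball 0 1) \<Delta> \<psi> (inv_into (ball 0 1) \<psi>)"
    and x: "x \<in> config \<Delta>" and y: "y \<in> config \<Delta>" and ell: "ell_defined \<psi> y x"
  shows "path_in (config \<Delta>) x y (ell \<psi> y x)"
proof -
  define \<theta> where "\<theta> = inv_into (ball 0 1) \<psi>"
  define L where "L = Max (range (\<lambda>i. dist (\<theta> (x i)) (\<theta> (y i))))"
  have \<psi>: "continuous_on (ball 0 1) \<psi>" "\<psi> ` ball 0 1 = \<Delta>" "\<And>a. a \<in> \<Delta> \<Longrightarrow> \<psi> (\<theta> a) = a \<and> \<theta> a \<in> ball 0 1"
    using hom unfolding homeomorphism_def \<theta>_def by auto
  have in_ball: "\<theta> (x i) \<in> ball 0 1" "\<theta> (y i) \<in> ball 0 1" for i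
    using \<psi>(3) x y unfolding config_def by blast+
  have \<psi>\<theta>: "\<psi> (\<theta> (x i)) = x i" "\<psi> (\<theta> (y i)) = y i" for i
    using \<psi>(3) x y unfolding config_def by blast+
  have L: "dist (\<theta> (x i)) (\<theta> (y i)) \<le> L" for i
    unfolding L_def by (intro Max_ge) auto
  then have L0: "0 \<le> L" using zero_le_dist order_trans by blast
  have e: "ell \<psi> y x = (\<lambda>t i. \<psi> (geodesic (\<theta> (x i)) (\<theta> (y i)) (t * L)))"
    unfolding ell_def Let_def \<theta>_def[symmetric] L_def[symmetric] ..
  have geo: "geodesic (\<theta> (x i)) (\<theta> (y i)) (t * L) \<in> ball 0 1" if "t \<in> {0..1}" for i t
    using in_ball that L0 by (intro geodesic_in_convex) auto
  have "continuous_on {0..1} (\<lambda>t. \<psi> (geodesic (\<theta> (x i)) (\<theta> (y i)) (t * L)))" for i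
  proof (rule continuous_on_compose2[OF \<psi>(1)])
    show "continuous_on {0..1} (\<lambda>t. geodesic (\<theta> (x i)) (\<theta> (y i)) (t * L))"
      by (rule continuous_on_compose2[OF continuous_on_geodesic]) (use L0 in \<open>auto intro!: continuous_intros\<close>)
  qed (use geo in auto)
  then have "path (ell \<psi> y x)"
    unfolding path_def e by (rule continuous_on_coordinatewise_then_product)
  moreover have "path_image (ell \<psi> y x) \<subseteq> config \<Delta>"
  proof
    fix w assume w: "w \<in> path_image (ell \<psi> y x)"
    then have "inj w" using ell unfolding ell_defined_def config_def by blast
    moreover have "range w \<subseteq> \<Delta>"
      using w geo \<psi>(2) unfolding e path_image_def by blast
    ultimately show "w \<in> config \<Delta>" unfolding config_def by simp
  qed
  moreover have "pathstart (ell \<psi> y x) = x" "pathfinish (ell \<psi> y x) = y"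
    using \<psi>\<theta> L unfolding pathstart_def pathfinish_def e by (simp_all add: geodesic_endpoints)
  ultimately show ?thesis unfolding path_in_def by simp
qed

section \<open>Linear growth of the braids along words\<close>

lemma foldr_Homeo0: "foldr (\<otimes>\<^bsub>Homeo0 A\<^esub>) ws \<one>\<^bsub>Homeo0 A\<^esub> = foldr (\<circ>) ws id"
  by (simp add: Homeo0_def)

lemma foldr_Homeo0_closed:
  "set ws \<subseteq> carrier (Homeo0 A) \<Longrightarrow> foldr (\<circ>) ws id \<in> carrier (Homeo0 A)"
  using group.foldr_closed[OF group_Homeo0] unfolding foldr_Homeo0 .

context braid_quasimorphism
begin

text \<open>Telescoping: the defect of \<open>s \<circ> g\<close> at x is at most that of g at x
  plus that of s at \<open>g \<circ> x\<close> plus 3 * D, since the value of b at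
  \<open>g \<circ> x\<close> cancels.\<close>

lemma gamma_word_bound:
  fixes \<Phi> :: "'e::euclidean_space \<Rightarrow> 'a" and \<psi> :: "real^'d::finite \<Rightarrow> 'a"
    and A :: "('a, 'd) chart set"
  assumes \<Delta>: "locally_contracts_into \<Delta>" and M: "compact (UNIV :: 'a set)"
    and dim: "2 \<le> DIM('e)" and \<Phi>: "continuous_on (cball 0 1) \<Phi>" "inj_on \<Phi> (ball 0 1)" "\<Phi> ` ball 0 1 = \<Delta>"
    and \<psi>: "homeomorphism (ball 0 1) \<Delta> \<psi> (inv_into (ball 0 1) \<psi>)"
    and isotopies: "\<forall>g\<in>carrier (Homeo0 A). isotopy (F g) g"
    and S: "finite S" "S \<subseteq> carrier (Homeo0 A)"
  shows "\<exists>C\<ge>0. \<forall>ws. set ws \<subseteq> S \<longrightarrow> (\<forall>x\<in>gamma_domain \<Delta> \<psi> z (foldr (\<circ>) ws id).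
    \<bar>\<phi> (gamma \<psi> z (F (foldr (\<circ>) ws id)) x)\<bar> \<le> C * (real (length ws) + 1))"
proof -
  note F = bspec[OF isotopies]
  from isotopy_coboundary[OF \<Delta> M dim \<Phi>] obtain b B where
    B: "\<forall>x\<in>config \<Delta>. \<bar>b x\<bar> \<le> B" and
    b: "\<forall>F f. isotopy F f \<longrightarrow> (\<exists>K. \<forall>x\<in>config UNIV. \<bar>val (\<lambda>t. F t \<circ> x) + b x - b (f \<circ> x)\<bar> \<le> K)"
    by (elim exE conjE)
  let ?G = "carrier (Homeo0 A)"
  let ?E = "\<lambda>g x. \<bar>val (\<lambda>t. F g t \<circ> x) + b x - b (g \<circ> x)\<bar>"
  have "\<forall>g\<in>?G. \<exists>K. \<forall>x\<in>config UNIV. ?E g x \<le> K"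
    using b F by blast
  then obtain K where K: "\<And>g x. g \<in> ?G \<Longrightarrow> x \<in> config UNIV \<Longrightarrow> ?E g x \<le> K g"
    by metis
  \<comment> \<open>One constant for all letters. The summand for \<open>id\<close> starts the
    induction at the empty word, as \<open>F id\<close> may be any loop of homeomorphisms at the
    identity.\<close>
  define C where "C = (\<Sum>s\<in>S. \<bar>K s\<bar>) + \<bar>K id\<bar>"
  have C0: "0 \<le> C" unfolding C_def by (intro add_nonneg_nonneg sum_nonneg) auto
  have CS: "K s \<le> C" if "s \<in> S" for s
    using member_le_sum[of s S "\<lambda>s. \<bar>K s\<bar>"] that S(1) unfolding C_def by auto
  have word: "?E (foldr (\<circ>) ws id) x \<le> C + (C + 3 * D) * real (length ws)"
    if "set ws \<subseteq> S" "x \<in> config UNIV" for ws x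
    using that
  proof (induction ws)
    case Nil
    have "id \<in> ?G" using foldr_Homeo0_closed[of "[]" A] by simp
    then have "?E id x \<le> K id" using K Nil by blast
    moreover have "0 \<le> (\<Sum>s\<in>S. \<bar>K s\<bar>)" by (intro sum_nonneg) auto
    then have "K id \<le> C" unfolding C_def using abs_ge_self[of "K id"] by linarith
    ultimately have e: "?E id x \<le> C" by linarith
    show ?case
      using e unfolding foldr.simps(1) id_apply list.size of_nat_0 mult_zero_right add_0_right .
  next
    case (Cons s ws)
    define g where "g = foldr (\<circ>) ws id"
    have G: "s \<in> ?G" "g \<in> ?G" "s \<circ> g \<in> ?G"
      using Cons.prems S(2) foldr_Homeo0_closed[of ws A] foldr_Homeo0_closed[of "s # ws" A] unfolding g_def by auto
    note flow = isotopy_flow[OF F[OF G(1)], where 'p = 'p] isotopy_flow[OF F[OF G(2)], where 'p = 'p]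
      isotopy_flow[OF F[OF G(3)], where 'p = 'p]
    have one: "F h 1 = h" if "h \<in> ?G" for h
      using F[OF that] unfolding isotopy_def by simp
    have x: "x \<in> config UNIV" using Cons.prems by simp
    have gx: "g \<circ> x \<in> config UNIV"
      using flow(2) one[OF G(2)] x unfolding flow_def by (metis atLeastAtMost_iff order_refl zero_le_one)
    have "\<bar>val (\<lambda>t. F (s \<circ> g) t \<circ> x) - val (\<lambda>t. F g t \<circ> x) - val (\<lambda>t. F s t \<circ> (g \<circ> x))\<bar> \<le> 3 * D"
      using val_flow_compose[OF flow(2,1,3) _ x] unfolding one[OF G(1)] one[OF G(2)] one[OF G(3)]
      by (simp add: comp_assoc)
    moreover have "set ws \<subseteq> S" using Cons.prems by simp
    then have "?E g x \<le> C + (C + 3 * D) * real (length ws)"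
      unfolding g_def using x by (rule Cons.IH)
    moreover have "?E s (g \<circ> x) \<le> C"
      using K[OF G(1) gx] CS[of s] Cons.prems by simp
    ultimately have "?E (s \<circ> g) x \<le> C + (C + 3 * D) * real (length ws) + C + 3 * D"
      unfolding comp_assoc by linarith
    also have "\<dots> = C + (C + 3 * D) * real (length (s # ws))"
      by (simp add: algebra_simps)
    also have "s \<circ> g = foldr (\<circ>) (s # ws) id"
      unfolding g_def by simp
    finally show ?case .
  qed
  have B0: "0 \<le> B" using B z_in abs_ge_zero order_trans by blast
  \<comment> \<open>The connecting paths have value 0. Two joins cost D each, and the passage from
    \<open>val\<close> to \<phi> on a loop at z costs 2 * D; both ends lie in \<Delta>, so each
    value of b contributes at most B.\<close>
  have gam: "\<bar>\<phi> (gamma \<psi> z (F g) x)\<bar> \<le> ?E g x + 2 * B + 4 * D"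
    if g: "g \<in> ?G" and x: "x \<in> gamma_domain \<Delta> \<psi> z g" for g x
  proof -
    have F1: "F g 1 = g" using F[OF g] unfolding isotopy_def by simp
    have dom: "x \<in> config \<Delta>" "g \<circ> x \<in> config \<Delta>" "ell_defined \<psi> x z" "ell_defined \<psi> z (g \<circ> x)"
      using x unfolding gamma_domain_def by auto
    have xC: "x \<in> config UNIV" using dom(1) L_subset by blast
    define p where "p = (\<lambda>t. F g t \<circ> x)"
    have q: "path_in (config \<Delta>) z x (ell \<psi> x z)" "path_in (config \<Delta>) (g \<circ> x) z (ell \<psi> z (g \<circ> x))"
      using ell_path[OF \<psi> z_in dom(1,3)] ell_path[OF \<psi> dom(2) z_in dom(4)] by auto
    note q' = path_in_mono[OF q(1) L_subset] path_in_mono[OF q(2) L_subset]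
    have p: "path_in (config UNIV) x (g \<circ> x) p"
      using flow_track[OF isotopy_flow[OF F[OF g]] xC] unfolding F1 p_def .
    have gam: "gamma \<psi> z (F g) x = path_class (config UNIV) (ell \<psi> x z +++ p +++ ell \<psi> z (g \<circ> x))"
      unfolding gamma_def F1 p_def ..
    have "\<bar>b x\<bar> \<le> B" "\<bar>b (g \<circ> x)\<bar> \<le> B" using B dom by auto
    then show ?thesis
      using val_base[OF path_in_join[OF q'(1) path_in_join[OF p q'(2)]]] val_join[OF q'(1) path_in_join[OF p q'(2)]]
        val_join[OF p q'(2)] val_local[OF q(1)] val_local[OF q(2)]
      unfolding gam p_def[symmetric] by linarith
  qed
  \<comment> \<open>The factor is the sum of the constant and the linear coefficient obtained from
    the two previous bounds.\<close>
  have "\<bar>\<phi> (gamma \<psi> z (F (foldr (\<circ>) ws id)) x)\<bar> \<le> (2 * C + 7 * D + 2 * B) * (real (length ws) + 1)"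
    if ws: "set ws \<subseteq> S" and x: "x \<in> gamma_domain \<Delta> \<psi> z (foldr (\<circ>) ws id)" for ws x
  proof -
    have xC: "x \<in> config UNIV" using x L_subset unfolding gamma_domain_def by blast
    have "foldr (\<circ>) ws id \<in> ?G" using ws S(2) by (intro foldr_Homeo0_closed) auto
    from gam[OF this x] word[OF ws xC]
    have "\<bar>\<phi> (gamma \<psi> z (F (foldr (\<circ>) ws id)) x)\<bar> \<le> C + (C + 3 * D) * real (length ws) + 2 * B + 4 * D"
      by linarith
    moreover have "0 \<le> (C + 4 * D + 2 * B) * real (length ws)" using C0 D_nonneg B0 by simp
    moreover have "0 \<le> C" "0 \<le> D" using C0 D_nonneg by auto
    ultimately show ?thesis by (simp add: algebra_simps)
  qed
  moreover have "0 \<le> 2 * C + 7 * D + 2 * B" using C0 D_nonneg B0 by simp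
  ultimately show ?thesis by blast
qed

end

text \<open>With a single strand the configurations of \<Delta> are a copy of the ball, where loops
  contract along straight lines. In dimension at least three this yields the vanishing of \<phi> on
  local braids that is assumed for surfaces.\<close>

lemma single_strand_null:
  fixes \<psi> :: "'e::euclidean_space \<Rightarrow> 'a::topological_space" and z :: "'p::finite \<Rightarrow> 'a"
  assumes hom: "homeomorphism (ball 0 1) \<Delta> \<psi> \<theta>" and n: "CARD('p) = 1"
    and p: "path_in (config \<Delta>) z z p"
  shows "homotopic_paths (config \<Delta>) p (\<lambda>_. z)"
proof -
  obtain i :: 'p where i: "\<And>j. j = i"
    using n by (metis UNIV_I card_1_singletonE singletonD)
  have \<psi>: "continuous_on (ball 0 1) \<psi>" "\<psi> ` ball 0 1 = \<Delta>" "continuous_on \<Delta> \<theta>" "\<theta> ` \<Delta> = ball 0 1" "\<And>a. a \<in> \<Delta> \<Longrightarrow> \<psi> (\<theta> a) = a"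
    using hom unfolding homeomorphism_def by auto
  have z: "z \<in> config \<Delta>"
    using p unfolding path_in_def by (metis pathstart_in_path_image subsetD)
  let ?q = "(\<lambda>x. \<theta> (x i)) \<circ> p" and ?g = "\<lambda>v j. \<psi> v :: 'a"
  have "continuous_on (config \<Delta>) (\<lambda>x::'p \<Rightarrow> 'a. \<theta> (x i))"
    by (rule continuous_on_compose2[OF \<psi>(3)])
      (auto intro: continuous_on_subset[OF continuous_on_product_coordinates] simp: config_def)
  then have q: "path_in (ball 0 1) (\<theta> (z i)) (\<theta> (z i)) ?q"
    by (rule path_in_image[OF p]) (use \<psi>(4) in \<open>unfold config_def, blast\<close>)
  have "homotopic_paths (ball 0 1) ?q (\<lambda>_. \<theta> (z i))"
  proof (rule homotopic_paths_linear)
    fix t :: real assume "t \<in> {0..1}"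
    then have "?q t \<in> ball 0 1"
      using q unfolding path_in_def path_image_def by blast
    moreover have "\<theta> (z i) \<in> ball 0 1"
      using \<psi>(4) z unfolding config_def by blast
    ultimately show "closed_segment (?q t) (\<theta> (z i)) \<subseteq> ball 0 1"
      by (intro closed_segment_subset) auto
  qed (use q path_in_const[of "\<theta> (z i)" UNIV] in \<open>auto simp: path_in_def\<close>)
  moreover have "continuous_on (ball 0 1) (\<lambda>v (j::'p). \<psi> v)"
    using \<psi>(1) by (intro continuous_on_coordinatewise_then_product)
  moreover have "(\<lambda>v (j::'p). \<psi> v) \<in> ball 0 1 \<rightarrow> config \<Delta>"
  proof
    fix v assume "v \<in> ball (0::'e) 1"
    moreover have "inj (\<lambda>j::'p. \<psi> v)" using i by (metis injI)
    ultimately show "(\<lambda>j::'p. \<psi> v) \<in> config \<Delta>" using \<psi>(2) unfolding config_def by auto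
  qed
  ultimately have "homotopic_paths (config \<Delta>) ((\<lambda>v (j::'p). \<psi> v) \<circ> ?q) ((\<lambda>v (j::'p). \<psi> v) \<circ> (\<lambda>_. \<theta> (z i)))"
    by (rule homotopic_paths_continuous_image)
  moreover have retr: "(\<lambda>j. \<psi> (\<theta> (x i))) = x" if "x \<in> config \<Delta>" for x :: "'p \<Rightarrow> 'a"
  proof
    fix j show "\<psi> (\<theta> (x i)) = x j" using that \<psi>(5) i[of j] unfolding config_def by auto
  qed
  moreover have "homotopic_paths (config \<Delta>) p ((\<lambda>v (j::'p). \<psi> v) \<circ> ?q)"
    using p by (intro path_in_homotopic_eq[OF p])
      (auto simp: path_in_def path_image_def comp_def intro!: retr[symmetric])
  ultimately show ?thesis
    using homotopic_paths_trans retr[OF z] by (simp add: comp_def)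
qed

theorem corollary1p7:
  fixes A :: "('a::t2_space, 'd::finite) chart set"
    and \<omega> :: "('a, 'd) chart \<Rightarrow> real^'d \<Rightarrow> real"
    and \<mu> :: "'a measure"
    and K :: "('a, 'd) cell set"
    and \<Delta> :: "'a set"
    and \<psi> :: "real^'d \<Rightarrow> 'a"
    and z :: "'p::finite \<Rightarrow> 'a"
    and \<phi> :: "(real \<Rightarrow> 'p \<Rightarrow> 'a) set \<Rightarrow> real"
    and F :: "('a \<Rightarrow> 'a) \<Rightarrow> real \<Rightarrow> 'a \<Rightarrow> 'a"
    and \<Psi> :: "('a \<Rightarrow> 'a) \<Rightarrow> real"
    and f :: "'a \<Rightarrow> 'a"
  assumes dim: "CARD('d) \<ge> 2"
    and points: "CARD('d) = 2 \<or> CARD('p) = 1"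
    and M: "oriented_atlas A" "compact (UNIV :: 'a set)" "connected (UNIV :: 'a set)"
    and mu: "volume_form A \<omega>" "volume_form_measure A \<omega> \<mu>" "prob_space \<mu>"
    and Delta: "unique_top_cell K \<Delta>" "diffeo_from_ball A \<psi> \<Delta>" "emeasure \<mu> \<Delta> = 1"
    and z: "z \<in> config \<Delta>"
    and phi: "quasimorphism (pure_braid_group z) \<phi>" "homogeneous (pure_braid_group z) \<phi>"
      "\<forall>b\<in>group_center (pure_braid_group z). \<phi> b = 0"
    and surface: "CARD('d) = 2 \<Longrightarrow>
      mboundary A = {} \<and> 0 < genus (UNIV :: 'a set) \<and> (\<forall>b\<in>local_braids \<Delta> z. \<phi> b = 0)"
    and F: "\<forall>g\<in>carrier (Homeo0 A). isotopy (F g) g"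
    and Psi: "\<forall>g\<in>carrier (Homeo0 A). \<Psi> g = Psi_integral \<mu> \<Delta> \<psi> z \<phi> (F g)"
    and f: "f \<in> carrier (Homeo0 A)"
    and growth: "limsup (\<lambda>k. ereal (\<bar>\<Psi> (f ^^ k)\<bar> / real k)) > 0"
  shows "undistorted (Homeo0 A) f"
proof -
  let ?C = "config UNIV :: ('p \<Rightarrow> 'a) set" and ?L = "config \<Delta> :: ('p \<Rightarrow> 'a) set"
  let ?P = "fundamental_group ?C z"
  have A: "smooth_atlas A" using M(1) unfolding oriented_atlas_def by simp
  have \<psi>: "homeomorphism (ball 0 1) \<Delta> \<psi> (inv_into (ball 0 1) \<psi>)"
    using Delta(2) unfolding diffeo_from_ball_def by simp
  have dim': "2 \<le> DIM(real^'d)" using dim by simp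
  have \<Delta>: "locally_contracts_into \<Delta>"
    unfolding locally_contracts_into_def small_contraction_def
    using local_contraction[OF A dim open_ball_image[OF A \<psi>] volume_dense[OF A mu Delta(3)]] by simp
  have "robust \<Delta>"
  proof -
    have "\<not> collinear (ball (0::real^'d) 1)" by (rule not_collinear_interior[OF dim']) auto
    moreover have "continuous_on (ball 0 1) \<psi>" "inj_on \<psi> (ball 0 1)" "\<psi> ` ball 0 1 = \<Delta>"
      using \<psi> unfolding homeomorphism_def by (auto intro: inj_on_inverseI)
    ultimately show ?thesis using robust_image[of "ball 0 1" \<psi>] by simp
  qed
  then have L: "path_connected ?L"
    unfolding config_eq_conf_box by (intro path_connected_conf_box)
  have sub: "?L \<subseteq> ?C" unfolding config_def by auto
  \<comment> \<open>The characteristic map of the cell is a second parametrization of \<Delta>. Its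
    continuity on the closed ball provides the compactness behind the finite covers, whereas \<psi>
    carries the geodesics. The subspace S is everything because its dimension is full.\<close>
  obtain \<Phi> :: "real^'d \<Rightarrow> 'a" where \<Phi>: "continuous_on (cball 0 1) \<Phi>" "inj_on \<Phi> (ball 0 1)" "\<Phi> ` ball 0 1 = \<Delta>"
  proof -
    obtain S \<Phi> where e: "(S, \<Phi>) \<in> K" "dim S = CARD('d)" "\<Delta> = \<Phi> ` (ball 0 1 \<inter> S)" and K: "cw_decomposition K"
      using Delta(1) unfolding unique_top_cell_def open_cell_def cell_dim_def by force
    from K e(1) have c: "subspace S" "continuous_on (cball 0 1 \<inter> S) \<Phi>"
      "\<exists>\<Theta>. homeomorphism (ball 0 1 \<inter> S) (\<Phi> ` (ball 0 1 \<inter> S)) \<Phi> \<Theta>"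
      unfolding cw_decomposition_def by auto
    have "span S = UNIV" using e(2) dim_eq_full[of S] by simp
    then have "S = UNIV" using c(1) by (metis span_eq_iff)
    then show ?thesis
      using that[of \<Phi>] c e(3) unfolding homeomorphism_def by (auto intro: inj_on_inverseI)
  qed
  obtain D where D: "\<And>g h. g \<in> carrier ?P \<Longrightarrow> h \<in> carrier ?P \<Longrightarrow> \<bar>\<phi> h - \<phi> (g \<otimes>\<^bsub>?P\<^esub> h) + \<phi> g\<bar> \<le> D"
    using phi(1) unfolding quasimorphism_def pure_braid_group_def by auto
  \<comment> \<open>Homogeneity with exponent 0 gives the value at the identity.\<close>
  have one: "\<phi> (path_class ?C (\<lambda>_. z)) = 0"
  proof -
    have "path_class ?C (\<lambda>_. z) \<in> carrier ?P"
      using path_in_const[of z ?C] z sub unfolding fundamental_group_carrier by blast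
    then have "\<phi> (path_class ?C (\<lambda>_. z) [^]\<^bsub>?P\<^esub> (0::int)) = of_int 0 * \<phi> (path_class ?C (\<lambda>_. z))"
      using phi(2) unfolding homogeneous_def pure_braid_group_def by blast
    then show ?thesis by (simp add: fundamental_group_def)
  qed
  \<comment> \<open>For surfaces this is the hypothesis on local braids; in higher dimension there
    is one strand, and its loops in \<Delta> are contractible.\<close>
  have local: "\<phi> (path_class ?C p) = 0" if p: "path_in ?L z z p" for p
  proof (cases "CARD('d) = 2")
    case True
    then show ?thesis
      using surface p unfolding local_braids_def loops_at_path_in[symmetric] by simp
  next
    case False
    then have "homotopic_paths ?L p (\<lambda>_. z)"
      using points by (intro single_strand_null[OF \<psi> _ p]) simp
    then have "homotopic_paths ?C p (\<lambda>_. z)"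
      by (rule homotopic_paths_subset[OF _ sub])
    then show ?thesis
      using path_class_eq_iff[OF path_in_mono[OF p sub], of "\<lambda>_. z"] one by simp
  qed
  interpret braid_quasimorphism \<Delta> z \<phi> D
    by unfold_locales
      (use sub z L path_connected_config[OF \<Delta> M(2) L] D phi(3) local in \<open>auto simp: pure_braid_group_def\<close>)
  show ?thesis
    unfolding undistorted_def
  proof (intro allI impI, elim conjE)
    fix H assume H: "subgroup H (Homeo0 A)" and fH: "f \<in> H"
    let ?G = "Homeo0 A\<lparr>carrier := H\<rparr>"
    interpret G: group ?G
      by (rule subgroup.subgroup_is_group[OF H group_Homeo0])
    have HG: "H \<subseteq> carrier (Homeo0 A)" by (rule subgroup.subset[OF H])
    have pow: "f [^]\<^bsub>?G\<^esub> k = f ^^ k" for k :: nat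
      by (induction k) (simp_all add: Homeo0_def funpow_Suc_right del: funpow.simps(2))
    show "undistorted_fg ?G f"
    proof (rule G.undistorted_fg_if_growth[OF _ _ growth])
      show "f \<in> carrier ?G" using fH by simp
      fix S assume S: "finite S" "generating_set ?G S"
      \<comment> \<open>Words may use inverses of generators, so these are added to the letters,
        which remain finite in number.\<close>
      let ?S = "S \<union> m_inv ?G ` S"
      have SH: "?S \<subseteq> H"
        using S(2) G.inv_closed unfolding generating_set_def by auto
      have finS: "finite ?S" using S(1) by simp
      obtain C where C: "0 \<le> C" "\<forall>ws. set ws \<subseteq> ?S \<longrightarrow> (\<forall>x\<in>gamma_domain \<Delta> \<psi> z (foldr (\<circ>) ws id).
          \<bar>\<phi> (gamma \<psi> z (F (foldr (\<circ>) ws id)) x)\<bar> \<le> C * (real (length ws) + 1))"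
        using gamma_word_bound[OF \<Delta> M(2) dim' \<Phi> \<psi> F finS order_trans[OF SH HG]] by (elim exE conjE)
      have "\<bar>\<Psi> (f ^^ k)\<bar> \<le> C * (real (length ws) + 1)" if "word ?G S (f [^]\<^bsub>?G\<^esub> k) ws" for k ws
      proof -
        have ws: "set ws \<subseteq> ?S" "foldr (\<circ>) ws id = f ^^ k"
          using that unfolding word_def pow by (simp_all add: Homeo0_def)
        have fk: "f ^^ k \<in> carrier (Homeo0 A)"
          using foldr_Homeo0_closed[OF order_trans[OF ws(1) order_trans[OF SH HG]]] unfolding ws(2) .
        \<comment> \<open>The isotopy chosen for \<open>f ^^ k\<close> is unrelated to those of the
          letters; the word bound already accounts for the central correction.\<close>
        have "F (f ^^ k) 1 = f ^^ k" using bspec[OF F fk] unfolding isotopy_def by simp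
        then have "\<bar>Psi_integral \<mu> \<Delta> \<psi> z \<phi> (F (f ^^ k))\<bar> \<le> C * (real (length ws) + 1)"
          using C(2)[rule_format, OF ws(1)] C(1) unfolding ws(2) by (intro Psi_integral_bound[OF mu(3)]) simp_all
        then show ?thesis using Psi fk by simp
      qed
      then show "\<exists>C. \<forall>k ws. word ?G S (f [^]\<^bsub>?G\<^esub> k) ws \<longrightarrow> \<bar>\<Psi> (f ^^ k)\<bar> \<le> C * (real (length ws) + 1)"
        by blast
    qed
  qed
qed

end
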